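(* There exists an absolute constant $c$ with $0<c<\pi$ such that for every real $\delta\ge \frac32$ and every $\theta$ with $0<\theta\le c$, the function $f_{\theta,\delta}(t)=(\theta-t)_+^{\delta}$ is isotropic positive definite on $\mathbb{S}^2$.
   Context: $(\theta-t)_+^{\delta}$ equals $(\theta-t)^\delta$ if $t\le\theta$ and $0$ if $t>\theta$. The unit sphere $\mathbb{S}^2=\{x\in\mathbb{R}^3:|x|=1\}$ carries the geodesic distance $\rho(x,y)=\arccos(x\cdot y)\in[0,\pi]$. A function $g:[0,\pi]\to\mathbb{R}$ is isotropic positive definite on $\mathbb{S}^2$ if for every $N\in\mathbb{N}$ and every set of $N$ distinct points $\{x_1,\dots,x_N\}\subset\mathbb{S}^2$, the symmetric matrix $\big(g(\rho(x_i,x_j))\big)_{i,j=1}^N$ is positive definite, i.e. $\mathbf{c}^T\big(g(\rho(x_i,x_j))\big)\mathbf{c}>0$ for all nonzero $\mathbf{c}\in\mathbb{R}^N$. *)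

theory Defs
  imports "HOL-Analysis.Analysis"
begin

text \<open>Truncated power. As \<open>0 powr \<delta> = 0\<close>, the value at \<open>t = \<theta>\<close> is 0, which is \<open>0\<^sup>\<delta>\<close>
  for the exponents \<open>\<delta> > 0\<close> of interest.\<close>

definition trunc_power :: "real \<Rightarrow> real \<Rightarrow> real \<Rightarrow> real" where
  "trunc_power \<theta> \<delta> t = (if t \<le> \<theta> then (\<theta> - t) powr \<delta> else 0)"

definition geodesic_dist :: "real^3 \<Rightarrow> real^3 \<Rightarrow> real" where
  "geodesic_dist x y = arccos (x \<bullet> y)"

text \<open>The \<open>N \<times> N\<close> matrix is given by its entries \<open>A i j\<close> with \<open>i, j < N\<close>. Symmetry is not part of
  the definition; the matrices it is applied to below are symmetric by construction.\<close>

definition positive_definite :: "nat \<Rightarrow> (nat \<Rightarrow> nat \<Rightarrow> real) \<Rightarrow> bool" where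
  "positive_definite N A \<longleftrightarrow>
     (\<forall>c :: nat \<Rightarrow> real. (\<exists>i<N. c i \<noteq> 0) \<longrightarrow> (\<Sum>i<N. \<Sum>j<N. c i * A i j * c j) > 0)"

text \<open>A function on \<open>[0, \<pi>]\<close> is represented by a total function, of which only the values on
  \<open>[0, \<pi>]\<close> (the range of \<^const>\<open>geodesic_dist\<close> on the unit sphere) matter.\<close>

definition isotropic_positive_definite :: "(real \<Rightarrow> real) \<Rightarrow> bool" where
  "isotropic_positive_definite g \<longleftrightarrow>
     (\<forall>(N::nat) (x :: nat \<Rightarrow> real^3).
        (\<forall>i<N. x i \<in> sphere 0 1) \<and> inj_on x {..<N} \<longrightarrow>
        positive_definite N (\<lambda>i j. g (geodesic_dist (x i) (x j))))"

end

theory Submission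
  imports Defs
begin

text \<open>
  Let \<open>x\<close>, \<open>y\<close> be unit vectors at angle \<open>t\<close>. Up to the factor \<open>\<pi> / 3\<close>, the number
  \<open>(\<theta> - t)\<^sub>+\<^sup>\<delta>\<close> is the integral of \<open>min (h\<^sub>x z) (h\<^sub>y z)\<close> over \<open>z\<close> in the unit ball of
  \<open>\<real>\<^sup>3\<close>, where \<open>h\<^sub>x z\<close> is a nonnegative decreasing function \<open>F\<close> of the squared sine of the angle
  between \<open>z\<close> and \<open>x\<close>, supported on the cone of half-angle \<open>\<theta> / 2\<close> about \<open>x\<close>. This is
  \<open>nn_integral_min_bump\<close>. Matrices \<open>min (a i) (a j)\<close> with \<open>a i \<ge> 0\<close> are positive semidefinite, so
  positivity is inherited by the integral. (Slicing \<open>h\<^sub>x\<close> into its level sets exhibits the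
  truncated power as a mixture of the areas in which two equal caps about \<open>x\<close> and \<open>y\<close> overlap.)

  The profile \<open>F\<close> comes from an Abel integral equation. The plane bisecting \<open>x\<close> and \<open>y\<close> separates
  the points at which \<open>h\<^sub>x\<close> is the minimum from those at which \<open>h\<^sub>y\<close> is. In coordinates
  \<open>z = u (x + \<tau> e + q n)\<close>, with \<open>e\<close> in the plane of \<open>x\<close> and \<open>y\<close> and \<open>n\<close> normal to it, the first
  side is \<open>\<tau> > tan (t / 2)\<close>. With \<open>F w = \<integral> m s / sqrt (s - w) ds\<close> over \<open>w < s < sin\<^sup>2 (\<theta> / 2)\<close>,
  the integrals over \<open>u\<close> and \<open>q\<close> are elementary and leave a tail integral of \<open>m\<close> for each
  \<open>\<tau>\<close>; differentiating \<open>(\<theta> - t)\<^sup>\<delta>\<close> shows that this tail has to be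
  \<open>E s = \<delta> (\<theta> - 2 arcsin (sqrt s))\<^sup>\<delta>\<^sup>-\<^sup>1 sqrt (1 - s)\<close>, that is, \<open>m = - E'\<close>.

  All of this is an identity; the one inequality needed is that \<open>F\<close> decreases. Put
  \<open>T = sin\<^sup>2 (\<theta> / 2)\<close>. The substitution \<open>s = w + (T - w) v\<close> gives
  \<open>F w = \<integral> sqrt (T - s) m s / sqrt (v (1 - v)) dv\<close> over \<open>0 < v < 1\<close>, so it suffices that
  \<open>sqrt (T - s) m s\<close> decreases in \<open>s\<close>. In the variable \<open>b = arcsin (sqrt s)\<close> this is
  \<open>(\<delta> / 2) (\<theta> - 2 b)\<^sup>\<delta>\<^sup>-\<^sup>3\<^sup>/\<^sup>2\<close> times a factor whose logarithmic derivative is at most about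
  \<open>- cot b / 2\<close> for small \<open>\<theta>\<close>. The condition \<open>\<delta> \<ge> 3 / 2\<close> enters here, and \<open>\<theta> \<le> 1 / 2\<close> is small
  enough.

  Strictness: \<open>F\<close> decreases strictly, so above a suitable level the functions \<open>h\<^sub>x\<close> live on small
  caps, which are disjoint for finitely many distinct centres. The parts above the level contribute
  a diagonal matrix with positive entries, the parts below it a semidefinite one.
\<close>

section \<open>Two one-dimensional integrals\<close>

text \<open>
  Only continuity is required at the endpoints: most integrands below are unbounded there, with an
  integrable singularity.
\<close>

lemma nn_integral_lborel_FTC:
  fixes F f :: "real \<Rightarrow> real"
  assumes "a \<le> b" "continuous_on {a..b} F"
    and "\<And>x. x \<in> {a<..<b} \<Longrightarrow> (F has_real_derivative f x) (at x)"
    and "\<And>x. x \<in> {a<..<b} \<Longrightarrow> 0 \<le> f x"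
  shows "(\<integral>\<^sup>+x. ennreal (f x) * indicator {a<..<b} x \<partial>lborel) = ennreal (F b - F a)"
proof -
  have "(f has_integral (F b - F a)) {a..b}"
    using assms by (intro fundamental_theorem_of_calculus_interior)
      (auto simp: has_real_derivative_iff_has_vector_derivative)
  then have "(f has_integral (F b - F a)) {a<..<b}"
    using has_integral_open_interval[of f "F b - F a" a b] by (simp add: box_real)
  then show ?thesis
    using nn_integral_has_integral_lebesgue'[of "{a<..<b}" f] assms(4) by auto
qed

text \<open>
  The substitution \<open>tan \<phi> = q sqrt (A + B) / sqrt (A (B - q\<^sup>2))\<close> makes the integrand constant. The
  antiderivative is written with \<open>arcsin\<close> because that form is continuous up to \<open>q = \<plusminus> sqrt B\<close>.
\<close>

lemma nn_integral_arcsine_rational: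
  fixes A B :: real
  assumes A: "0 < A" and B: "0 < B"
  shows "(\<integral>\<^sup>+q. ennreal (1 / ((A + q\<^sup>2) * sqrt (B - q\<^sup>2))) * indicator {q. q\<^sup>2 < B} q \<partial>lborel)
    = ennreal (pi / sqrt (A * (A + B)))"
proof -
  let ?c = "sqrt (A * (A + B))"
  let ?g = "\<lambda>q. q * sqrt (A + B) / (sqrt B * sqrt (A + q\<^sup>2))"
  let ?F = "\<lambda>q. arcsin (?g q) / ?c"
  have set: "{q. q\<^sup>2 < B} = {- sqrt B<..<sqrt B}"
    by (auto simp: abs_less_iff real_sqrt_less_iff[of "_\<^sup>2" B, symmetric] simp del: real_sqrt_less_iff)
  have pos: "0 < A + q\<^sup>2" for q using A by (simp add: add_pos_nonneg)
  have sq: "(?g q)\<^sup>2 = q\<^sup>2 * (A + B) / (B * (A + q\<^sup>2))" for q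
    using A B pos[of q] by (simp add: power_divide power_mult_distrib)
  have one: "1 - (?g q)\<^sup>2 = A * (B - q\<^sup>2) / (B * (A + q\<^sup>2))" for q
  proof -
    have "B * (A + q\<^sup>2) \<noteq> 0" using B pos[of q] by simp
    then have "1 - (?g q)\<^sup>2 = (B * (A + q\<^sup>2) - q\<^sup>2 * (A + B)) / (B * (A + q\<^sup>2))"
      unfolding sq by (metis diff_divide_distrib divide_self)
    then show ?thesis by (simp add: algebra_simps)
  qed
  have end1: "?g (sqrt B) = 1" "?g (- sqrt B) = -1" using A B by auto
  have le: "\<bar>?g q\<bar> \<le> 1" if "q\<^sup>2 \<le> B" for q
  proof -
    have "0 \<le> 1 - (?g q)\<^sup>2" unfolding one using that A B pos[of q] by simp
    then show ?thesis by (simp add: abs_square_le_1)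
  qed
  have lt: "\<bar>?g q\<bar> < 1" if "q\<^sup>2 < B" for q
  proof -
    have "0 < 1 - (?g q)\<^sup>2" unfolding one using that A B pos[of q] by simp
    then show ?thesis by (simp add: abs_square_less_1)
  qed
  have qB: "q\<^sup>2 \<le> B" if "q \<in> {- sqrt B..sqrt B}" for q
    using that B abs_le_square_iff[of q "sqrt B"] by (auto simp: abs_le_iff)
  have cont: "continuous_on {- sqrt B..sqrt B} ?F"
  proof (rule continuous_on_divide)
    show "continuous_on {- sqrt B..sqrt B} (\<lambda>q. arcsin (?g q))"
    proof (rule continuous_on_arcsin)
      show "continuous_on {- sqrt B..sqrt B} ?g"
        using B pos by (intro continuous_intros) (auto simp: less_imp_neq[THEN not_sym])
      show "\<forall>q\<in>{- sqrt B..sqrt B}. - 1 \<le> ?g q \<and> ?g q \<le> 1"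
      proof
        fix q assume "q \<in> {- sqrt B..sqrt B}"
        then have "\<bar>?g q\<bar> \<le> 1" by (intro le qB)
        then show "- 1 \<le> ?g q \<and> ?g q \<le> 1" by linarith
      qed
    qed
  qed (use A B in simp_all)
  have der: "(?F has_real_derivative 1 / ((A + q\<^sup>2) * sqrt (B - q\<^sup>2))) (at q)" if "q \<in> {- sqrt B<..<sqrt B}" for q
  proof -
    have q: "q\<^sup>2 < B" using that set by blast
    note p = pos[of q]
    define r where "r = sqrt (A + q\<^sup>2)"
    have r: "0 < r" "r * r = A + q\<^sup>2" using p by (simp_all add: r_def)
    have "((\<lambda>q. sqrt (A + q\<^sup>2)) has_real_derivative q / r) (at q)"
    proof -
      have "((\<lambda>q. A + q\<^sup>2) has_real_derivative 2 * q) (at q)"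
        by (auto intro!: derivative_eq_intros)
      from DERIV_chain2[OF DERIV_real_sqrt[OF p] this] show ?thesis
        by (simp add: r_def inverse_eq_divide)
    qed
    from DERIV_divide[OF DERIV_ident this]
    have "((\<lambda>q. q / sqrt (A + q\<^sup>2)) has_real_derivative (1 * r - q * (q / r)) / (r * r)) (at q)"
      using p by (simp add: r_def)
    also have "(1 * r - q * (q / r)) / (r * r) = A / ((A + q\<^sup>2) * r)"
    proof -
      have "1 * r - q * (q / r) = (r * r - q\<^sup>2) / r"
        using r(1) by (simp add: diff_divide_distrib power2_eq_square)
      then show ?thesis using r by simp
    qed
    finally have "((\<lambda>q. sqrt (A + B) / sqrt B * (q / sqrt (A + q\<^sup>2))) has_real_derivative
        (sqrt (A+B) / sqrt B) * (A / ((A + q\<^sup>2) * r))) (at q)"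
      by (rule DERIV_cmult)
    then have g': "(?g has_real_derivative (sqrt (A+B) / sqrt B) * (A / ((A + q\<^sup>2) * sqrt (A + q\<^sup>2)))) (at q)"
      by (simp add: r_def mult.commute)
    have "sqrt (1 - (?g q)\<^sup>2) = sqrt A * sqrt (B - q\<^sup>2) / (sqrt B * sqrt (A + q\<^sup>2))"
      unfolding one by (simp add: real_sqrt_mult real_sqrt_divide)
    moreover have b: "- 1 < ?g q" "?g q < 1" using lt[OF q] by linarith+
    note DERIV_cdivide[OF DERIV_chain2[OF DERIV_arcsin[OF b] g'], of ?c]
    ultimately have "(?F has_real_derivative inverse (sqrt A * sqrt (B - q\<^sup>2) / (sqrt B * sqrt (A + q\<^sup>2))) * ((sqrt (A+B) / sqrt B) * (A / ((A + q\<^sup>2) * sqrt (A + q\<^sup>2)))) / ?c) (at q)"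
      by (simp only:)
    also have "inverse (sqrt A * sqrt (B - q\<^sup>2) / (sqrt B * sqrt (A + q\<^sup>2))) * ((sqrt (A+B) / sqrt B) * (A / ((A + q\<^sup>2) * sqrt (A + q\<^sup>2)))) / ?c
      = (A / (sqrt A * sqrt A)) * (sqrt B / sqrt B) * (sqrt (A + q\<^sup>2) / sqrt (A + q\<^sup>2)) * (sqrt (A + B) / sqrt (A + B))
        / ((A + q\<^sup>2) * sqrt (B - q\<^sup>2))"
      by (simp only: real_sqrt_mult divide_inverse inverse_mult_distrib inverse_inverse_eq mult_ac)
    also have "\<dots> = 1 / ((A + q\<^sup>2) * sqrt (B - q\<^sup>2))"
      using A B p by simp
    finally show ?thesis .
  qed
  have "(\<integral>\<^sup>+q. ennreal (1 / ((A + q\<^sup>2) * sqrt (B - q\<^sup>2))) * indicator {- sqrt B<..<sqrt B} q \<partial>lborel)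
    = ennreal (?F (sqrt B) - ?F (- sqrt B))"
  proof (intro nn_integral_lborel_FTC cont der)
    fix q assume "q \<in> {- sqrt B<..<sqrt B}"
    then have "q\<^sup>2 < B" using set by blast
    then show "0 \<le> 1 / ((A + q\<^sup>2) * sqrt (B - q\<^sup>2))" using pos[of q] by simp
  qed (use B in auto)
  also have "?F (sqrt B) - ?F (- sqrt B) = pi / ?c"
    unfolding end1 by (simp add: arcsin_minus_1 field_simps)
  finally show ?thesis unfolding set .
qed

section \<open>Slope coordinates in three-space\<close>

text \<open>
  Enough to compare both measures on boxes; the preimage of a box is its image under the
  inverse isometry, which preserves volume.
\<close>

lemma distr_lborel_orthogonal_transformation:
  fixes L :: "real^'n::{finite,wellorder} \<Rightarrow> real^'n::_"
  assumes L: "orthogonal_transformation L"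
  shows "distr lborel borel L = lborel"
proof (rule sym, rule lborel_eqI)
  have lin: "linear L" using L by (simp add: orthogonal_transformation_linear)
  have meas[measurable]: "L \<in> borel_measurable borel"
    using lin by (intro borel_measurable_continuous_onI linear_continuous_on linear_conv_bounded_linear[THEN iffD1])
  fix l u :: "real^'n::_" assume lu: "\<And>b. b \<in> Basis \<Longrightarrow> l \<bullet> b \<le> u \<bullet> b"
  have inv: "orthogonal_transformation (inv L)" using L by (rule orthogonal_transformation_inv)
  have vim: "L -` box l u = inv L ` box l u"
    using L by (metis bij_vimage_eq_inv_image orthogonal_transformation_bij)
  have "emeasure (distr lborel borel L) (box l u) = emeasure lborel (L -` box l u)"
    by (subst emeasure_distr) auto
  also have "\<dots> = emeasure lebesgue (L -` box l u)"
    using measurable_sets[OF meas, of "box l u"] by simp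
  also have "\<dots> = ennreal (measure lebesgue (inv L ` box l u))"
    unfolding vim using measurable_orthogonal_image[OF inv lmeasurable_box] by (simp add: emeasure_eq_measure2)
  also have "\<dots> = ennreal (measure lebesgue (box l u))"
    using measure_orthogonal_image[OF inv lmeasurable_box] by simp
  also have "\<dots> = ennreal (\<Prod>b\<in>Basis. (u - l) \<bullet> b)"
    using lu by (simp add: measure_lborel_box)
  finally show "emeasure (distr lborel borel L) (box l u) = ennreal (\<Prod>b\<in>Basis. (u - l) \<bullet> b)" .
qed simp

lemma distr_lborel_vector_3:
  "distr lborel borel (\<lambda>(u::real, v::real, w::real). vector [u, v, w] :: real^3) = lborel"
proof (rule sym, rule lborel_eqI)
  let ?V = "\<lambda>(u::real, v::real, w::real). vector [u, v, w] :: real^3"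
  have V: "?V = (\<lambda>p. fst p *\<^sub>R axis 1 1 + fst (snd p) *\<^sub>R axis 2 1 + snd (snd p) *\<^sub>R axis 3 1)"
    by (auto simp: fun_eq_iff vec_eq_iff forall_3 axis_def)
  have meas[measurable]: "?V \<in> borel_measurable borel"
    unfolding V by (intro borel_measurable_continuous_onI continuous_intros)
  fix l u :: "real^3" assume lu: "\<And>b. b \<in> Basis \<Longrightarrow> l \<bullet> b \<le> u \<bullet> b"
  have le: "l $ i \<le> u $ i" for i
    using lu[of "axis i 1"] by (simp add: inner_axis)
  have vim: "?V -` box l u = box (l$1, l$2, l$3) (u$1, u$2, u$3)"
    by (auto simp: mem_box_cart forall_3 box_prod mem_Times_iff box_real)
  have B: "(Basis :: (real^3) set) = {axis 1 1, axis 2 1, axis 3 1}"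
    by (auto simp: Basis_vec_def UNIV_3)
  have "emeasure (distr lborel borel ?V) (box l u) = emeasure lborel (?V -` box l u)"
    by (subst emeasure_distr) auto
  also have "\<dots> = ennreal (\<Prod>b\<in>Basis. ((u$1, u$2, u$3) - (l$1, l$2, l$3)) \<bullet> b)"
    unfolding vim by (subst emeasure_lborel_box) (auto simp: Basis_prod_def le)
  also have "(\<Prod>b\<in>Basis. ((u$1, u$2, u$3) - (l$1, l$2, l$3)) \<bullet> b) = (u$1 - l$1) * (u$2 - l$2) * (u$3 - l$3)"
    by (simp add: Basis_prod_def image_Un)
  also have "\<dots> = (\<Prod>b\<in>Basis. (u - l) \<bullet> b)"
    by (simp add: B axis_eq_axis inner_axis algebra_simps)
  finally show "emeasure (distr lborel borel ?V) (box l u) = ennreal (\<Prod>b\<in>Basis. (u - l) \<bullet> b)" .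
qed simp

lemma nn_integral_orthonormal_frame:
  fixes e1 e2 e3 :: "real^3" and g :: "real^3 \<Rightarrow> ennreal"
  assumes e: "norm e1 = 1" "norm e2 = 1" "norm e3 = 1" "e1 \<bullet> e2 = 0" "e1 \<bullet> e3 = 0" "e2 \<bullet> e3 = 0"
    and g[measurable]: "g \<in> borel_measurable borel"
  shows "(\<integral>\<^sup>+z. g z \<partial>lborel) = (\<integral>\<^sup>+u. \<integral>\<^sup>+v. \<integral>\<^sup>+w. g (u *\<^sub>R e1 + v *\<^sub>R e2 + w *\<^sub>R e3) \<partial>lborel \<partial>lborel \<partial>lborel)"
proof -
  define L where "L = (\<lambda>z::real^3. z$1 *\<^sub>R e1 + z$2 *\<^sub>R e2 + z$3 *\<^sub>R e3)"
  have lin: "linear L" unfolding L_def by (intro linearI) (auto simp: algebra_simps)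
  have sq: "e1 \<bullet> e1 = 1" "e2 \<bullet> e2 = 1" "e3 \<bullet> e3 = 1" "e2 \<bullet> e1 = 0" "e3 \<bullet> e1 = 0" "e3 \<bullet> e2 = 0"
    using e by (auto simp: norm_eq_1 inner_commute)
  have orth: "orthogonal_transformation L"
    unfolding orthogonal_transformation_def
  proof (intro conjI allI lin)
    fix v w
    have "L v \<bullet> L w = v$1 * w$1 + v$2 * w$2 + v$3 * w$3"
      by (simp add: L_def inner_add_left inner_add_right sq e(4-6))
    then show "L v \<bullet> L w = v \<bullet> w" by (simp add: inner_vec_def sum_3)
  qed
  have Lm[measurable]: "L \<in> borel_measurable borel"
    using lin by (intro borel_measurable_continuous_onI linear_continuous_on linear_conv_bounded_linear[THEN iffD1])
  let ?V = "\<lambda>(u::real, v::real, w::real). vector [u, v, w] :: real^3"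
  have V: "?V = (\<lambda>p. fst p *\<^sub>R axis 1 1 + fst (snd p) *\<^sub>R axis 2 1 + snd (snd p) *\<^sub>R axis 3 1)"
    by (auto simp: fun_eq_iff vec_eq_iff forall_3 axis_def)
  have Vm[measurable]: "?V \<in> borel_measurable borel"
    unfolding V by (intro borel_measurable_continuous_onI continuous_intros)
  have gm: "(\<lambda>p. g (fst p *\<^sub>R e1 + fst (snd p) *\<^sub>R e2 + snd (snd p) *\<^sub>R e3)) \<in> borel_measurable borel"
    by (rule measurable_compose[OF _ g]) (intro borel_measurable_continuous_onI continuous_intros)
  have "(\<integral>\<^sup>+z. g z \<partial>lborel) = (\<integral>\<^sup>+z. g (L z) \<partial>lborel)"
    by (subst distr_lborel_orthogonal_transformation[OF orth, symmetric]) (simp add: nn_integral_distr)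
  also have "\<dots> = (\<integral>\<^sup>+p. g (L (?V p)) \<partial>lborel)"
    by (subst distr_lborel_vector_3[symmetric]) (simp add: nn_integral_distr)
  also have "\<dots> = (\<integral>\<^sup>+p. g (fst p *\<^sub>R e1 + fst (snd p) *\<^sub>R e2 + snd (snd p) *\<^sub>R e3) \<partial>lborel)"
    by (intro nn_integral_cong) (auto simp: L_def)
  also have "\<dots> = (\<integral>\<^sup>+u. \<integral>\<^sup>+p. g (u *\<^sub>R e1 + fst p *\<^sub>R e2 + snd p *\<^sub>R e3) \<partial>lborel \<partial>lborel)"
    unfolding lborel_prod[symmetric]
    by (subst sigma_finite_measure.nn_integral_fst[symmetric])
       (simp_all add: lborel_prod lborel.sigma_finite_measure_axioms gm)
  also have "\<dots> = (\<integral>\<^sup>+u. \<integral>\<^sup>+v. \<integral>\<^sup>+w. g (u *\<^sub>R e1 + v *\<^sub>R e2 + w *\<^sub>R e3) \<partial>lborel \<partial>lborel \<partial>lborel)"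
    unfolding lborel_prod[symmetric]
    by (intro nn_integral_cong, subst lborel.nn_integral_fst[symmetric]) simp_all
  finally show ?thesis .
qed

text \<open>
  On the half space \<open>z \<bullet> e1 > 0\<close> the coordinates are the height \<open>u\<close> along \<open>e1\<close> and the two slopes;
  the Jacobian \<open>u\<^sup>2\<close> comes from rescaling the two transversal variables by \<open>u\<close>.
\<close>

lemma nn_integral_slope_coordinates:
  fixes e1 e2 e3 :: "real^3" and g :: "real^3 \<Rightarrow> ennreal"
  assumes e: "norm e1 = 1" "norm e2 = 1" "norm e3 = 1" "e1 \<bullet> e2 = 0" "e1 \<bullet> e3 = 0" "e2 \<bullet> e3 = 0"
    and g[measurable]: "g \<in> borel_measurable borel"
  shows "(\<integral>\<^sup>+z. g z * indicator {z. 0 < z \<bullet> e1} z \<partial>lborel)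
    = (\<integral>\<^sup>+t. \<integral>\<^sup>+q. \<integral>\<^sup>+u. ennreal (u\<^sup>2) * g (u *\<^sub>R (e1 + t *\<^sub>R e2 + q *\<^sub>R e3)) * indicator {0<..} u
        \<partial>lborel \<partial>lborel \<partial>lborel)"
proof -
  let ?h = "\<lambda>u t q. ennreal (u\<^sup>2) * g (u *\<^sub>R (e1 + t *\<^sub>R e2 + q *\<^sub>R e3)) * indicator {0<..} u"
  have sq: "e1 \<bullet> e1 = 1" "e2 \<bullet> e1 = 0" "e3 \<bullet> e1 = 0"
    using e by (auto simp: norm_eq_1 inner_commute)
  have [measurable]: "{z::real^3. 0 < z \<bullet> e1} \<in> sets borel"
    by (intro borel_open open_Collect_less continuous_intros)
  have slice: "(\<integral>\<^sup>+v. \<integral>\<^sup>+w. g (u *\<^sub>R e1 + v *\<^sub>R e2 + w *\<^sub>R e3)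
      * indicator {z. 0 < z \<bullet> e1} (u *\<^sub>R e1 + v *\<^sub>R e2 + w *\<^sub>R e3) \<partial>lborel \<partial>lborel)
    = (\<integral>\<^sup>+t. \<integral>\<^sup>+q. ?h u t q \<partial>lborel \<partial>lborel)" for u
  proof (cases "0 < u")
    case False
    then show ?thesis by (simp add: inner_add_left sq indicator_def)
  next
    case True
    have "(\<integral>\<^sup>+v. \<integral>\<^sup>+w. g (u *\<^sub>R e1 + v *\<^sub>R e2 + w *\<^sub>R e3) \<partial>lborel \<partial>lborel)
       = ennreal u * (\<integral>\<^sup>+t. \<integral>\<^sup>+w. g (u *\<^sub>R e1 + (u * t) *\<^sub>R e2 + w *\<^sub>R e3) \<partial>lborel \<partial>lborel)"
      using True by (subst nn_integral_real_affine[where c=u and t=0]) simp_all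
    also have "(\<lambda>t. \<integral>\<^sup>+w. g (u *\<^sub>R e1 + (u * t) *\<^sub>R e2 + w *\<^sub>R e3) \<partial>lborel)
      = (\<lambda>t. ennreal u * (\<integral>\<^sup>+q. g (u *\<^sub>R e1 + (u * t) *\<^sub>R e2 + (u * q) *\<^sub>R e3) \<partial>lborel))"
      using True by (intro ext, subst nn_integral_real_affine[where c=u and t=0]) simp_all
    finally have "(\<integral>\<^sup>+v. \<integral>\<^sup>+w. g (u *\<^sub>R e1 + v *\<^sub>R e2 + w *\<^sub>R e3) \<partial>lborel \<partial>lborel)
       = (\<integral>\<^sup>+t. \<integral>\<^sup>+q. ?h u t q \<partial>lborel \<partial>lborel)"
      using True by (simp add: nn_integral_cmult power2_eq_square ennreal_mult mult.assoc scaleR_add_right)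
    then show ?thesis using True by (simp add: inner_add_left sq)
  qed
  have "(\<integral>\<^sup>+z. g z * indicator {z. 0 < z \<bullet> e1} z \<partial>lborel)
    = (\<integral>\<^sup>+u. \<integral>\<^sup>+t. \<integral>\<^sup>+q. ?h u t q \<partial>lborel \<partial>lborel \<partial>lborel)"
    by (subst nn_integral_orthonormal_frame[OF e], measurable) (simp only: slice)
  also have "\<dots> = (\<integral>\<^sup>+t. \<integral>\<^sup>+u. \<integral>\<^sup>+q. ?h u t q \<partial>lborel \<partial>lborel \<partial>lborel)"
    by (rule lborel_pair.Fubini') measurable
  also have "\<dots> = (\<integral>\<^sup>+t. \<integral>\<^sup>+q. \<integral>\<^sup>+u. ?h u t q \<partial>lborel \<partial>lborel \<partial>lborel)"
    by (intro nn_integral_cong lborel_pair.Fubini') measurable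
  finally show ?thesis .
qed

text \<open>
  For a function of the direction only, the radial integral can be carried out. The point with
  slopes \<open>t\<close>, \<open>q\<close> and height \<open>u\<close> has norm \<open>u sqrt (1 + t\<^sup>2 + q\<^sup>2)\<close>, so \<open>u\<close> runs up to
  \<open>1 / sqrt (1 + t\<^sup>2 + q\<^sup>2)\<close>. The remaining weight is one third of the area element of the sphere
  in the central projection to the plane tangent at \<open>e1\<close>.
\<close>

lemma nn_integral_homogeneous_half_ball:
  fixes e1 e2 e3 :: "real^3" and \<Phi> :: "real^3 \<Rightarrow> ennreal"
  assumes e: "norm e1 = 1" "norm e2 = 1" "norm e3 = 1" "e1 \<bullet> e2 = 0" "e1 \<bullet> e3 = 0" "e2 \<bullet> e3 = 0"
    and [measurable]: "\<Phi> \<in> borel_measurable borel"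
    and hom: "\<And>u z. 0 < u \<Longrightarrow> \<Phi> (u *\<^sub>R z) = \<Phi> z"
  shows "(\<integral>\<^sup>+z. \<Phi> z * indicator {z. norm z \<le> 1 \<and> 0 < z \<bullet> e1} z \<partial>lborel)
    = (\<integral>\<^sup>+t. \<integral>\<^sup>+q. \<Phi> (e1 + t *\<^sub>R e2 + q *\<^sub>R e3)
        * ennreal (1 / (3 * (1 + t\<^sup>2 + q\<^sup>2) * sqrt (1 + t\<^sup>2 + q\<^sup>2))) \<partial>lborel \<partial>lborel)"
proof -
  have sq: "e1 \<bullet> e1 = 1" "e2 \<bullet> e2 = 1" "e3 \<bullet> e3 = 1" "e2 \<bullet> e1 = 0" "e3 \<bullet> e1 = 0" "e3 \<bullet> e2 = 0"
    using e by (auto simp: norm_eq_1 inner_commute)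
  have [measurable]: "{z::real^3. norm z \<le> 1} \<in> sets borel"
    by (intro borel_closed closed_Collect_le continuous_intros)
  let ?g = "\<lambda>z. \<Phi> z * indicator {z. norm z \<le> 1} z"
  have radial: "(\<integral>\<^sup>+u. ennreal (u\<^sup>2) * ?g (u *\<^sub>R (e1 + t *\<^sub>R e2 + q *\<^sub>R e3)) * indicator {0<..} u \<partial>lborel)
     = \<Phi> (e1 + t *\<^sub>R e2 + q *\<^sub>R e3) * ennreal (1 / (3 * (1 + t\<^sup>2 + q\<^sup>2) * sqrt (1 + t\<^sup>2 + q\<^sup>2)))"
    for t q
  proof -
    let ?p = "e1 + t *\<^sub>R e2 + q *\<^sub>R e3" and ?s = "1 + t\<^sup>2 + q\<^sup>2"
    have s: "0 < ?s" by (simp add: add_pos_nonneg)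
    have np: "norm ?p = sqrt ?s"
      by (simp add: norm_eq_sqrt_inner inner_add_left inner_add_right sq e power2_eq_square)
    have b: "0 < 1 / sqrt ?s" using s by simp
    have cube: "(1 / sqrt ?s) ^ 3 / 3 = 1 / (3 * ?s * sqrt ?s)"
      using s by (simp add: power3_eq_cube)
    have "(\<integral>\<^sup>+u. ennreal (u\<^sup>2) * indicator {0<..<1 / sqrt ?s} u \<partial>lborel) = ennreal ((1 / sqrt ?s) ^ 3 / 3 - 0 ^ 3 / 3)"
      using b by (intro nn_integral_lborel_FTC) (auto intro!: derivative_eq_intros continuous_intros)
    then have base: "(\<integral>\<^sup>+u. ennreal (u\<^sup>2) * indicator {0<..<1 / sqrt ?s} u \<partial>lborel) = ennreal (1 / (3 * ?s * sqrt ?s))"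
      unfolding cube by simp
    have "AE u in lborel. u \<noteq> 1 / sqrt ?s" by (rule AE_lborel_singleton)
    then have "(\<integral>\<^sup>+u. ennreal (u\<^sup>2) * ?g (u *\<^sub>R ?p) * indicator {0<..} u \<partial>lborel)
      = (\<integral>\<^sup>+u. \<Phi> ?p * (ennreal (u\<^sup>2) * indicator {0<..<1 / sqrt ?s} u) \<partial>lborel)"
    proof (intro nn_integral_cong_AE, eventually_elim)
      case (elim u)
      show ?case
      proof (cases "0 < u")
        case True
        then have "norm (u *\<^sub>R ?p) \<le> 1 \<longleftrightarrow> u \<le> 1 / sqrt ?s"
          using s unfolding norm_scaleR np by (simp add: field_simps)
        then have "norm (u *\<^sub>R ?p) \<le> 1 \<longleftrightarrow> u < 1 / sqrt ?s"
          using elim by (metis less_le)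
        then show ?thesis using True
          by (simp add: hom indicator_def ac_simps del: scaleR_add_right)
      qed simp
    qed
    also have "\<dots> = \<Phi> ?p * ennreal (1 / (3 * ?s * sqrt ?s))"
      by (subst nn_integral_cmult) (simp_all only: base, measurable)
    finally show ?thesis .
  qed
  have "(\<integral>\<^sup>+z. \<Phi> z * indicator {z. norm z \<le> 1 \<and> 0 < z \<bullet> e1} z \<partial>lborel)
    = (\<integral>\<^sup>+z. ?g z * indicator {z. 0 < z \<bullet> e1} z \<partial>lborel)"
    by (intro nn_integral_cong) (auto simp: indicator_def)
  also have "\<dots> = (\<integral>\<^sup>+t. \<integral>\<^sup>+q. \<integral>\<^sup>+u. ennreal (u\<^sup>2) * ?g (u *\<^sub>R (e1 + t *\<^sub>R e2 + q *\<^sub>R e3)) * indicator {0<..} u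
        \<partial>lborel \<partial>lborel \<partial>lborel)"
    by (intro nn_integral_slope_coordinates e) measurable
  finally show ?thesis unfolding radial .
qed

section \<open>Abel transforms as radial profiles\<close>

definition abel_transform :: "(real \<Rightarrow> ennreal) \<Rightarrow> real \<Rightarrow> ennreal" where
  "abel_transform m w = (\<integral>\<^sup>+s. m s * ennreal (1 / sqrt (s - w)) * indicator {w<..} s \<partial>lborel)"

lemma borel_measurable_abel_transform [measurable]:
  assumes [measurable]: "m \<in> borel_measurable borel"
  shows "abel_transform m \<in> borel_measurable borel"
proof -
  have "(\<lambda>w. \<integral>\<^sup>+s. m s * ennreal (1 / sqrt (s - w)) * indicator {p. fst p < snd p} (w, s) \<partial>lborel) \<in> borel_measurable borel"
    by measurable
  then show ?thesis
    by (simp add: abel_transform_def[abs_def] indicator_def)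
qed

text \<open>
  The number \<open>1 - 1 / (1 + t\<^sup>2 + q\<^sup>2)\<close> is the squared sine of the angle between \<open>e1\<close> and the direction
  with slopes \<open>t\<close>, \<open>q\<close>. After interchanging the integrals over \<open>q\<close> and \<open>s\<close>, the inner one is
  evaluated by \<open>nn_integral_arcsine_rational\<close>, and it does not depend on \<open>s\<close>. This is what makes
  the Abel kernel \<open>1 / sqrt (s - w)\<close> the right one: integrating a profile across the slice of
  slope \<open>t\<close> gives a plain tail integral of \<open>m\<close>.
\<close>

lemma nn_integral_gnomonic_abel_transform:
  fixes m :: "real \<Rightarrow> ennreal" and t :: real
  assumes [measurable]: "m \<in> borel_measurable borel"
    and m0: "\<And>s. s \<notin> {0<..<1} \<Longrightarrow> m s = 0"
  shows "(\<integral>\<^sup>+q. abel_transform m (1 - 1 / (1 + t\<^sup>2 + q\<^sup>2))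
           * ennreal (1 / (3 * (1 + t\<^sup>2 + q\<^sup>2) * sqrt (1 + t\<^sup>2 + q\<^sup>2))) \<partial>lborel)
    = ennreal (pi / (3 * sqrt (1 + t\<^sup>2))) * (\<integral>\<^sup>+s. m s * indicator {t\<^sup>2 / (1 + t\<^sup>2)<..} s \<partial>lborel)"
proof -
  define A where "A = 1 + t\<^sup>2"
  have A: "0 < A" "1 \<le> A" by (simp_all add: A_def add_pos_nonneg)
  have Aq: "0 < A + q\<^sup>2" for q using A by (simp add: add_pos_nonneg)
  have tA: "t\<^sup>2 / A = 1 - 1 / A" using A by (simp add: A_def field_simps)
  let ?k = "\<lambda>q s. ennreal (1 / sqrt (s - (1 - 1 / (A + q\<^sup>2)))) * indicator {p. 1 - 1 / (A + (fst p)\<^sup>2) < snd p} (q, s)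
     * ennreal (1 / (3 * (A + q\<^sup>2) * sqrt (A + q\<^sup>2)))"
  have inner: "(\<integral>\<^sup>+q. ?k q s \<partial>lborel) = ennreal (pi / (3 * sqrt A)) * indicator {1 - 1/A<..} s"
    if s: "0 < s" "s < 1" for s
  proof -
    \<comment> \<open>With \<open>k = 1 - s\<close>, the condition on \<open>q\<close> reads \<open>k (A + q\<^sup>2) < 1\<close>, that is, \<open>q\<^sup>2 < B\<close>.\<close>
    define k where "k = 1 - s"
    have k: "0 < k" "k < 1" using s by (auto simp: k_def)
    define B where "B = 1 / k - A"
    have iff: "1 - 1 / (A + q\<^sup>2) < s \<longleftrightarrow> q\<^sup>2 < B" for q
      using Aq[of q] k by (simp add: B_def k_def field_simps)
    have iff0: "1 - 1 / A < s \<longleftrightarrow> 0 < B" using iff[of 0] by simp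
    show ?thesis
    proof (cases "0 < B")
      case False
      then have "\<not> q\<^sup>2 < B" for q by (smt (verit) zero_le_power2)
      then have "?k q s = 0" for q using iff by simp
      then show ?thesis using False iff0 by (simp only:) simp
    next
      case True
      have "?k q s = ennreal (1 / (3 * sqrt k)) * (ennreal (1 / ((A + q\<^sup>2) * sqrt (B - q\<^sup>2))) * indicator {q. q\<^sup>2 < B} q)" for q
      proof (cases "q\<^sup>2 < B")
        case q: True
        have "s - (1 - 1 / (A + q\<^sup>2)) = k * (B - q\<^sup>2) / (A + q\<^sup>2)"
        proof -
          have "k * (B - q\<^sup>2) = 1 - k * (A + q\<^sup>2)"
            using k by (simp add: B_def field_simps)
          then show ?thesis using Aq[of q] by (simp add: k_def diff_divide_distrib)
        qed
        then have "1 / sqrt (s - (1 - 1 / (A + q\<^sup>2))) * (1 / (3 * (A + q\<^sup>2) * sqrt (A + q\<^sup>2)))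
          = 1 / (3 * sqrt k) * (1 / ((A + q\<^sup>2) * sqrt (B - q\<^sup>2)))"
          using Aq[of q] k q by (simp add: real_sqrt_mult real_sqrt_divide)
        then show ?thesis using q iff[of q] k Aq[of q]
          by (simp flip: ennreal_mult' add: less_imp_le)
      next
        case False
        then show ?thesis using iff by simp
      qed
      then have "(\<integral>\<^sup>+q. ?k q s \<partial>lborel)
        = ennreal (1 / (3 * sqrt k)) * (\<integral>\<^sup>+q. ennreal (1 / ((A + q\<^sup>2) * sqrt (B - q\<^sup>2))) * indicator {q. q\<^sup>2 < B} q \<partial>lborel)"
        by (simp only:) (subst nn_integral_cmult, measurable)
      also have "\<dots> = ennreal (1 / (3 * sqrt k) * (pi / sqrt (A * (A + B))))"
        using A True k by (simp add: nn_integral_arcsine_rational flip: ennreal_mult)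
      also have "1 / (3 * sqrt k) * (pi / sqrt (A * (A + B))) = pi / (3 * sqrt A)"
        using A k by (simp add: B_def real_sqrt_mult real_sqrt_divide)
      finally show ?thesis using True iff0 by simp
    qed
  qed
  have [measurable]: "(\<lambda>x. indicator {p::real\<times>real. 1 - 1 / (A + (fst p)\<^sup>2) < snd p} x :: ennreal) \<in> borel_measurable (lborel \<Otimes>\<^sub>M lborel)"
    by measurable
  have "(\<integral>\<^sup>+q. abel_transform m (1 - 1 / (A + q\<^sup>2)) * ennreal (1 / (3 * (A + q\<^sup>2) * sqrt (A + q\<^sup>2))) \<partial>lborel)
      = (\<integral>\<^sup>+q. \<integral>\<^sup>+s. m s * ?k q s \<partial>lborel \<partial>lborel)"
    unfolding abel_transform_def
    by (intro nn_integral_cong, subst nn_integral_multc[symmetric], measurable)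
       (auto intro!: nn_integral_cong simp: indicator_def mult.assoc)
  also have "\<dots> = (\<integral>\<^sup>+s. \<integral>\<^sup>+q. m s * ?k q s \<partial>lborel \<partial>lborel)"
    by (rule lborel_pair.Fubini') measurable
  also have "\<dots> = (\<integral>\<^sup>+s. m s * (\<integral>\<^sup>+q. ?k q s \<partial>lborel) \<partial>lborel)"
    by (intro nn_integral_cong nn_integral_cmult) measurable
  also have "\<dots> = (\<integral>\<^sup>+s. ennreal (pi / (3 * sqrt A)) * (m s * indicator {1 - 1/A<..} s) \<partial>lborel)"
  proof (intro nn_integral_cong)
    fix s :: real
    show "m s * (\<integral>\<^sup>+q. ?k q s \<partial>lborel) = ennreal (pi / (3 * sqrt A)) * (m s * indicator {1 - 1/A<..} s)"
    proof (cases "s \<in> {0<..<1}")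
      case True
      then show ?thesis using inner[of s] by (simp add: ac_simps)
    qed (simp add: m0)
  qed
  also have "\<dots> = ennreal (pi / (3 * sqrt A)) * (\<integral>\<^sup>+s. m s * indicator {1 - 1/A<..} s \<partial>lborel)"
    by (rule nn_integral_cmult) measurable
  finally show ?thesis unfolding A_def[symmetric] tA .
qed

text \<open>
  The set \<open>A\<close> restricts the slope of \<open>z\<close> in the direction \<open>e\<close>; half-lines \<open>A\<close> give the part of the
  cone on one side of a plane that contains the normal of \<open>x\<close> and \<open>e\<close>.
\<close>

lemma nn_integral_abel_profile_cone:
  fixes x e :: "real^3" and m :: "real \<Rightarrow> ennreal"
  assumes x: "norm x = 1" and e: "norm e = 1" "x \<bullet> e = 0"
    and [measurable]: "m \<in> borel_measurable borel" "A \<in> sets borel"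
    and m0: "\<And>s. s \<notin> {0<..<1} \<Longrightarrow> m s = 0"
  shows "(\<integral>\<^sup>+z. abel_transform m (1 - (z \<bullet> x / norm z)\<^sup>2) * indicator {z. (z \<bullet> e) / (z \<bullet> x) \<in> A} z
             * indicator {z. norm z \<le> 1 \<and> 0 < z \<bullet> x} z \<partial>lborel)
    = (\<integral>\<^sup>+t. ennreal (pi / (3 * sqrt (1 + t\<^sup>2))) * (\<integral>\<^sup>+s. m s * indicator {t\<^sup>2 / (1 + t\<^sup>2)<..} s \<partial>lborel)
             * indicator A t \<partial>lborel)"
proof -
  define n where "n = cross3 x e"
  have sq: "x \<bullet> x = 1" "e \<bullet> e = 1" "e \<bullet> x = 0" using x e by (auto simp: norm_eq_1 inner_commute)
  have n: "norm n = 1" "x \<bullet> n = 0" "e \<bullet> n = 0"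
    using norm_cross_dot[of x e] x e dot_cross_self[of x e] dot_cross_self[of e x]
    by (auto simp: n_def power2_eq_1_iff) (smt (verit) norm_ge_zero)
  have nn: "n \<bullet> n = 1" "n \<bullet> x = 0" "n \<bullet> e = 0" using n by (auto simp: norm_eq_1 inner_commute)
  have [measurable]: "(\<lambda>z::real^3. z \<bullet> x) \<in> borel_measurable borel" "(\<lambda>z::real^3. z \<bullet> e) \<in> borel_measurable borel"
    by measurable
  let ?\<Phi> = "\<lambda>z. abel_transform m (1 - (z \<bullet> x / norm z)\<^sup>2) * indicator A ((z \<bullet> e) / (z \<bullet> x)) :: ennreal"
  have "(\<integral>\<^sup>+z. ?\<Phi> z * indicator {z. norm z \<le> 1 \<and> 0 < z \<bullet> x} z \<partial>lborel)
    = (\<integral>\<^sup>+t. \<integral>\<^sup>+q. ?\<Phi> (x + t *\<^sub>R e + q *\<^sub>R n)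
        * ennreal (1 / (3 * (1 + t\<^sup>2 + q\<^sup>2) * sqrt (1 + t\<^sup>2 + q\<^sup>2))) \<partial>lborel \<partial>lborel)"
    using x e n by (intro nn_integral_homogeneous_half_ball) auto
  also have "\<dots> = (\<integral>\<^sup>+t. \<integral>\<^sup>+q. abel_transform m (1 - 1 / (1 + t\<^sup>2 + q\<^sup>2))
        * ennreal (1 / (3 * (1 + t\<^sup>2 + q\<^sup>2) * sqrt (1 + t\<^sup>2 + q\<^sup>2))) * indicator A t \<partial>lborel \<partial>lborel)"
  proof (intro nn_integral_cong)
    fix t q :: real
    have "norm (x + t *\<^sub>R e + q *\<^sub>R n) = sqrt (1 + t\<^sup>2 + q\<^sup>2)"
      by (simp add: norm_eq_sqrt_inner inner_add_left inner_add_right sq nn e n power2_eq_square)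
    moreover have "(x + t *\<^sub>R e + q *\<^sub>R n) \<bullet> x = 1" "(x + t *\<^sub>R e + q *\<^sub>R n) \<bullet> e = t"
      by (simp_all add: inner_add_left sq nn e)
    ultimately show "?\<Phi> (x + t *\<^sub>R e + q *\<^sub>R n) * ennreal (1 / (3 * (1 + t\<^sup>2 + q\<^sup>2) * sqrt (1 + t\<^sup>2 + q\<^sup>2)))
      = abel_transform m (1 - 1 / (1 + t\<^sup>2 + q\<^sup>2))
        * ennreal (1 / (3 * (1 + t\<^sup>2 + q\<^sup>2) * sqrt (1 + t\<^sup>2 + q\<^sup>2))) * indicator A t"
      by (simp add: power_divide ac_simps)
  qed
  also have "\<dots> = (\<integral>\<^sup>+t. (\<integral>\<^sup>+q. abel_transform m (1 - 1 / (1 + t\<^sup>2 + q\<^sup>2))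
        * ennreal (1 / (3 * (1 + t\<^sup>2 + q\<^sup>2) * sqrt (1 + t\<^sup>2 + q\<^sup>2))) \<partial>lborel) * indicator A t \<partial>lborel)"
    by (intro nn_integral_cong nn_integral_multc) measurable
  also have "\<dots> = (\<integral>\<^sup>+t. ennreal (pi / (3 * sqrt (1 + t\<^sup>2))) * (\<integral>\<^sup>+s. m s * indicator {t\<^sup>2 / (1 + t\<^sup>2)<..} s \<partial>lborel)
             * indicator A t \<partial>lborel)"
    by (subst nn_integral_gnomonic_abel_transform[OF assms(4) m0]) simp_all
  finally show ?thesis by (simp add: indicator_def)
qed

section \<open>The density that produces a truncated power\<close>

text \<open>
  This is \<open>- E'\<close> for \<open>E s = \<delta> (\<theta> - 2 arcsin (sqrt s)) powr (\<delta> - 1) * sqrt (1 - s)\<close>, a function that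
  vanishes at \<open>s = (sin (\<theta> / 2))\<^sup>2\<close>.
\<close>

definition tail_density :: "real \<Rightarrow> real \<Rightarrow> real \<Rightarrow> real" where
  "tail_density \<theta> \<delta> s = \<delta> * ((\<delta> - 1) * (\<theta> - 2 * arcsin (sqrt s)) powr (\<delta> - 2) / sqrt s
      + (\<theta> - 2 * arcsin (sqrt s)) powr (\<delta> - 1) / (2 * sqrt (1 - s)))"

definition tail_weight :: "real \<Rightarrow> real \<Rightarrow> real \<Rightarrow> ennreal" where
  "tail_weight \<theta> \<delta> s = ennreal (tail_density \<theta> \<delta> s) * indicator {0<..<(sin (\<theta> / 2))\<^sup>2} s"

lemma tail_density_nonneg: "1 \<le> \<delta> \<Longrightarrow> 0 \<le> s \<Longrightarrow> s \<le> 1 \<Longrightarrow> 0 \<le> tail_density \<theta> \<delta> s"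
  by (simp add: tail_density_def)

lemma minus_one_less_sqrt: "0 \<le> s \<Longrightarrow> - 1 < sqrt s"
  by (rule less_le_trans[of _ 0]) simp_all

lemma borel_measurable_tail_weight [measurable]: "tail_weight \<theta> \<delta> \<in> borel_measurable borel"
proof -
  let ?b = "\<lambda>s::real. indicator {0<..<1} s *\<^sub>R arcsin (sqrt s)"
  have [measurable]: "?b \<in> borel_measurable borel"
    by (intro borel_measurable_continuous_on_indicator continuous_intros) (auto simp: minus_one_less_sqrt less_imp_le)
  have "(\<lambda>s. ennreal (\<delta> * ((\<delta> - 1) * (\<theta> - 2 * ?b s) powr (\<delta> - 2) / sqrt s
      + (\<theta> - 2 * ?b s) powr (\<delta> - 1) / (2 * sqrt (1 - s)))) * indicator {0<..<1} s) \<in> borel_measurable borel"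
    by measurable
  also have "(\<lambda>s. ennreal (\<delta> * ((\<delta> - 1) * (\<theta> - 2 * ?b s) powr (\<delta> - 2) / sqrt s
      + (\<theta> - 2 * ?b s) powr (\<delta> - 1) / (2 * sqrt (1 - s)))) * indicator {0<..<1} s)
    = (\<lambda>s. ennreal (tail_density \<theta> \<delta> s) * indicator {0<..<1} s)"
    by (auto simp: fun_eq_iff indicator_def tail_density_def)
  finally have "(\<lambda>s. ennreal (tail_density \<theta> \<delta> s) * indicator {0<..<1} s) \<in> borel_measurable borel" .
  then have "(\<lambda>s. ennreal (tail_density \<theta> \<delta> s) * indicator {0<..<1} s * indicator {0<..<(sin (\<theta> / 2))\<^sup>2} s) \<in> borel_measurable borel"
    by measurable
  also have "(\<lambda>s. ennreal (tail_density \<theta> \<delta> s) * indicator {0<..<1} s * indicator {0<..<(sin (\<theta> / 2))\<^sup>2} s) = tail_weight \<theta> \<delta>"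
  proof
    fix s :: real
    have "(sin (\<theta> / 2))\<^sup>2 \<le> 1" by (simp add: abs_square_le_1)
    then show "ennreal (tail_density \<theta> \<delta> s) * indicator {0<..<1} s * indicator {0<..<(sin (\<theta> / 2))\<^sup>2} s = tail_weight \<theta> \<delta> s"
      by (auto simp: tail_weight_def indicator_def)
  qed
  finally show ?thesis .
qed

lemma sin_squared_less_iff:
  fixes a b :: real
  assumes "0 \<le> a" "a \<le> pi / 2" "0 \<le> b" "b \<le> pi / 2"
  shows "(sin a)\<^sup>2 < (sin b)\<^sup>2 \<longleftrightarrow> a < b"
proof -
  have "0 \<le> sin a" "0 \<le> sin b" using assms by (auto intro!: sin_ge_zero)
  then have "(sin a)\<^sup>2 < (sin b)\<^sup>2 \<longleftrightarrow> sin a < sin b"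
    by (metis abs_le_square_iff abs_of_nonneg not_le)
  then show ?thesis using assms by (simp add: sin_mono_less_eq)
qed

lemma arcsin_sqrt_sin_squared: "0 \<le> b \<Longrightarrow> b \<le> pi / 2 \<Longrightarrow> arcsin (sqrt ((sin b)\<^sup>2)) = b"
  using pi_gt_zero by (simp add: sin_ge_zero arcsin_sin abs_of_nonneg)

lemma arcsin_sqrt_bounds:
  assumes "0 < s" "s < (sin k)\<^sup>2" "0 \<le> k" "k \<le> pi / 2"
  shows "0 < arcsin (sqrt s)" "arcsin (sqrt s) < k" "(sin (arcsin (sqrt s)))\<^sup>2 = s"
proof -
  have s1: "s < 1" using assms(2) using abs_square_le_1[of "sin k"] by simp
  have b: "arcsin 0 < arcsin (sqrt s)" using assms s1 by (intro arcsin_less_arcsin) auto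
  then show "0 < arcsin (sqrt s)" by simp
  show e: "(sin (arcsin (sqrt s)))\<^sup>2 = s"
    using assms s1 by (subst sin_arcsin) (auto simp: minus_one_less_sqrt less_imp_le)
  have "arcsin (sqrt s) \<le> pi / 2" using assms s1 by (intro arcsin_ubound) (auto simp: minus_one_less_sqrt less_imp_le)
  then show "arcsin (sqrt s) < k"
    using sin_squared_less_iff[of "arcsin (sqrt s)" k] assms b e by auto
qed

text \<open>
  The fundamental theorem of calculus for \<open>E\<close>, evaluated at \<open>s = (sin b)\<^sup>2\<close>. For \<open>\<delta> < 2\<close> the density is
  unbounded near the right endpoint.
\<close>

lemma nn_integral_tail_weight_tail:
  assumes \<theta>: "0 < \<theta>" "\<theta> < pi" and \<delta>: "1 < \<delta>" and b: "0 \<le> b" "b < pi / 2"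
  shows "(\<integral>\<^sup>+s. tail_weight \<theta> \<delta> s * indicator {(sin b)\<^sup>2<..} s \<partial>lborel)
    = ennreal (\<delta> * (\<theta> - 2 * b) powr (\<delta> - 1) * cos b) * indicator {..<\<theta> / 2} b"
proof (cases "b < \<theta> / 2")
  case False
  have "(sin (\<theta> / 2))\<^sup>2 \<le> (sin b)\<^sup>2"
    using sin_squared_less_iff[of b "\<theta>/2"] False b \<theta> by auto
  then have "(\<integral>\<^sup>+s. tail_weight \<theta> \<delta> s * indicator {(sin b)\<^sup>2<..} s \<partial>lborel) = (\<integral>\<^sup>+s. 0 \<partial>(lborel :: real measure))"
    by (intro nn_integral_cong) (auto simp: tail_weight_def indicator_def)
  then show ?thesis using False by simp
next
  case True
  let ?T = "(sin (\<theta> / 2))\<^sup>2" and ?F = "\<lambda>s. - (\<delta> * (\<theta> - 2 * arcsin (sqrt s)) powr (\<delta> - 1) * sqrt (1 - s))"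
  have T: "(sin b)\<^sup>2 < ?T" "?T < 1"
    using sin_squared_less_iff[of b "\<theta>/2"] sin_squared_less_iff[of "\<theta>/2" "pi/2"] True b \<theta> by auto
  have Tarc: "arcsin (sqrt ?T) = \<theta> / 2" using \<theta> by (intro arcsin_sqrt_sin_squared) auto
  have rng: "0 \<le> s \<and> s \<le> 1" if "s \<in> {(sin b)\<^sup>2..?T}" for s
    using that T by (auto intro: order_trans[OF zero_le_power2])
  have le: "0 \<le> \<theta> - 2 * arcsin (sqrt s)" if "s \<in> {(sin b)\<^sup>2..?T}" for s
  proof -
    have "arcsin (sqrt s) \<le> arcsin (sqrt ?T)"
      using that rng[OF that] T by (intro arcsin_le_arcsin real_sqrt_le_mono) (auto simp: minus_one_less_sqrt less_imp_le)
    then show ?thesis unfolding Tarc by simp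
  qed
  have cont: "continuous_on {(sin b)\<^sup>2..?T} ?F"
  proof -
    have "continuous_on {(sin b)\<^sup>2..?T} (\<lambda>s. \<theta> - 2 * arcsin (sqrt s))"
      using rng by (intro continuous_intros ballI) (auto simp: minus_one_less_sqrt less_imp_le)
    then have "continuous_on {(sin b)\<^sup>2..?T} (\<lambda>s. (\<theta> - 2 * arcsin (sqrt s)) powr (\<delta> - 1))"
      by (rule continuous_on_powr'[OF _ continuous_on_const]) (use le \<delta> in auto)
    then show ?thesis by (intro continuous_on_minus continuous_on_mult continuous_on_real_sqrt continuous_on_diff continuous_on_const continuous_on_id)
  qed
  have der: "(?F has_real_derivative tail_density \<theta> \<delta> s) (at s)" if s: "s \<in> {(sin b)\<^sup>2<..<?T}" for s
  proof -
    have s01: "0 < s" "s < 1" using s T by (auto intro: le_less_trans[OF zero_le_power2])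
    have x: "0 < \<theta> - 2 * arcsin (sqrt s)"
      using arcsin_sqrt_bounds(2)[of s "\<theta>/2"] s01 s \<theta> by auto
    have "((\<lambda>s. arcsin (sqrt s)) has_real_derivative inverse (sqrt (1 - (sqrt s)\<^sup>2)) * (inverse (sqrt s) / 2)) (at s)"
      using s01 minus_one_less_sqrt[of s] by (intro DERIV_chain2[OF DERIV_arcsin DERIV_real_sqrt]) simp_all
    from DERIV_diff[OF DERIV_const DERIV_cmult[OF this, of 2], of \<theta>] have dx: "((\<lambda>s. \<theta> - 2 * arcsin (sqrt s)) has_real_derivative - (1 / (sqrt (1 - s) * sqrt s))) (at s)"
      using s01 by (simp add: inverse_eq_divide)
    have dp: "((\<lambda>s. (\<theta> - 2 * arcsin (sqrt s)) powr (\<delta> - 1)) has_real_derivative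
        ((\<delta> - 1) * (\<theta> - 2 * arcsin (sqrt s)) powr (\<delta> - 2) * - (1 / (sqrt (1 - s) * sqrt s)))) (at s)"
      using DERIV_fun_powr[OF dx x, of "\<delta> - 1"] by (simp add: algebra_simps)
    have dq: "((\<lambda>s. sqrt (1 - s)) has_real_derivative - (1 / (2 * sqrt (1 - s)))) (at s)"
    proof -
      have "((\<lambda>s. 1 - s) has_real_derivative - 1) (at s)" by (auto intro!: derivative_eq_intros)
      from DERIV_chain2[OF DERIV_real_sqrt this] show ?thesis using s01 by (simp add: inverse_eq_divide mult.commute)
    qed
    have r: "sqrt (1 - s) \<noteq> 0" using s01 by simp
    have "(?F has_real_derivative - (\<delta> * (((\<delta> - 1) * (\<theta> - 2 * arcsin (sqrt s)) powr (\<delta> - 2) * - (1 / (sqrt (1 - s) * sqrt s))) * sqrt (1 - s)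
       + - (1 / (2 * sqrt (1 - s))) * (\<theta> - 2 * arcsin (sqrt s)) powr (\<delta> - 1)))) (at s)"
      using DERIV_minus[OF DERIV_cmult[OF DERIV_mult[OF dp dq], of \<delta>]] by (simp only: mult.assoc)
    also have "- (\<delta> * (((\<delta> - 1) * (\<theta> - 2 * arcsin (sqrt s)) powr (\<delta> - 2) * - (1 / (sqrt (1 - s) * sqrt s))) * sqrt (1 - s)
       + - (1 / (2 * sqrt (1 - s))) * (\<theta> - 2 * arcsin (sqrt s)) powr (\<delta> - 1))) = tail_density \<theta> \<delta> s"
    proof -
      have "- (\<delta> * ((c * P * - (1 / (u * v))) * u + - (1 / (2 * u)) * Q)) = \<delta> * (c * P / v + Q / (2 * u))"
        if "u \<noteq> 0" for c P Q u v :: real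
        using that by (simp add: ring_distribs)
      then show ?thesis unfolding tail_density_def using r by blast
    qed
    finally show ?thesis .
  qed
  have "(\<integral>\<^sup>+s. tail_weight \<theta> \<delta> s * indicator {(sin b)\<^sup>2<..} s \<partial>lborel)
    = (\<integral>\<^sup>+s. ennreal (tail_density \<theta> \<delta> s) * indicator {(sin b)\<^sup>2<..<?T} s \<partial>lborel)"
    by (intro nn_integral_cong) (auto simp: tail_weight_def indicator_def intro: le_less_trans[OF zero_le_power2])
  also have "\<dots> = ennreal (?F ?T - ?F ((sin b)\<^sup>2))"
  proof (intro nn_integral_lborel_FTC cont der)
    show "0 \<le> tail_density \<theta> \<delta> s" if "s \<in> {(sin b)\<^sup>2<..<?T}" for s
      using rng[of s] that \<delta> by (intro tail_density_nonneg) auto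
  qed (use T in auto)
  also have "?F ?T - ?F ((sin b)\<^sup>2) = \<delta> * (\<theta> - 2 * b) powr (\<delta> - 1) * cos b"
  proof -
    have "sqrt (1 - (sin b)\<^sup>2) = cos b" using b by (simp add: cos_squared_eq[symmetric] cos_ge_zero)
    then show ?thesis using b Tarc arcsin_sqrt_sin_squared[of b] by simp
  qed
  finally show ?thesis using True by simp
qed

text \<open>
  The substitution \<open>b = arctan t\<close> turns the integrand into a multiple of the derivative of
  \<open>(\<theta> - 2 b) powr \<delta>\<close>. Both the open and the closed half-line are covered, so that the two sides of a
  bisecting plane can be described by complementary conditions.
\<close>

lemma nn_integral_sector_tail_weight:
  assumes \<theta>: "0 < \<theta>" "\<theta> < pi" and \<delta>: "1 < \<delta>" and a: "0 \<le> a" "a < pi / 2"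
    and A: "{tan a<..} \<subseteq> A" "A \<subseteq> {tan a..}"
  shows "(\<integral>\<^sup>+t. ennreal (pi / (3 * sqrt (1 + t\<^sup>2)))
        * (\<integral>\<^sup>+s. tail_weight \<theta> \<delta> s * indicator {t\<^sup>2 / (1 + t\<^sup>2)<..} s \<partial>lborel) * indicator A t \<partial>lborel)
    = ennreal (pi / 6 * trunc_power \<theta> \<delta> (2 * a))"
proof -
  let ?x = "\<lambda>t. \<theta> - 2 * arctan t"
  let ?f = "\<lambda>t. pi / 3 * (\<delta> * ?x t powr (\<delta> - 1)) / (1 + t\<^sup>2)"
  have ta: "0 \<le> tan a" using a by (auto intro: tan_gt_zero less_imp_le simp: le_less)
  have at: "arctan (tan a) = a" "arctan (tan (\<theta>/2)) = \<theta>/2" using a \<theta> by (simp_all add: arctan_tan)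
  have lt: "t < tan (\<theta>/2) \<longleftrightarrow> arctan t < \<theta>/2" for t
    using arctan_less_iff[of t "tan (\<theta>/2)"] at by simp
  have integrand: "ennreal (pi / (3 * sqrt (1 + t\<^sup>2)))
        * (\<integral>\<^sup>+s. tail_weight \<theta> \<delta> s * indicator {t\<^sup>2 / (1 + t\<^sup>2)<..} s \<partial>lborel) * indicator A t
      = ennreal (?f t) * indicator {tan a<..<tan (\<theta>/2)} t" if "t \<noteq> tan a" for t
  proof (cases "tan a < t")
    case True
    have p: "0 < 1 + t\<^sup>2" by (simp add: add_pos_nonneg)
    have "0 \<le> arctan t" "arctan t < pi/2" using True ta arctan_ubound[of t] by auto
    moreover have "t\<^sup>2 / (1 + t\<^sup>2) = (sin (arctan t))\<^sup>2"
      using p by (simp add: sin_arctan power_divide)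
    ultimately have "(\<integral>\<^sup>+s. tail_weight \<theta> \<delta> s * indicator {t\<^sup>2 / (1 + t\<^sup>2)<..} s \<partial>lborel)
      = ennreal (\<delta> * ?x t powr (\<delta> - 1) / sqrt (1 + t\<^sup>2)) * indicator {..<tan (\<theta>/2)} t"
      using nn_integral_tail_weight_tail[OF \<theta> \<delta>, of "arctan t"] by (simp add: cos_arctan lt indicator_def)
    moreover have "pi / (3 * sqrt (1 + t\<^sup>2)) * (\<delta> * ?x t powr (\<delta> - 1) / sqrt (1 + t\<^sup>2)) = ?f t"
    proof -
      have "pi / (3 * r) * (c / r) = pi / 3 * c / (r * r)" for r c :: real by simp
      then show ?thesis using p by (simp only:) simp
    qed
    moreover have "t \<in> A" using A True by auto
    ultimately show ?thesis using True \<delta> p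
      by (auto simp: indicator_def simp flip: ennreal_mult')
  next
    case False
    then show ?thesis using that A by (auto simp: indicator_def)
  qed
  have "AE t in lborel. t \<noteq> tan a" by (rule AE_lborel_singleton)
  then have "(\<integral>\<^sup>+t. ennreal (pi / (3 * sqrt (1 + t\<^sup>2)))
        * (\<integral>\<^sup>+s. tail_weight \<theta> \<delta> s * indicator {t\<^sup>2 / (1 + t\<^sup>2)<..} s \<partial>lborel) * indicator A t \<partial>lborel)
    = (\<integral>\<^sup>+t. ennreal (?f t) * indicator {tan a<..<tan (\<theta>/2)} t \<partial>lborel)"
    by (intro nn_integral_cong_AE, eventually_elim) (rule integrand)
  also have "\<dots> = ennreal (pi / 6 * trunc_power \<theta> \<delta> (2 * a))"
  proof (cases "a < \<theta>/2")
    case False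
    then have "{tan a<..<tan (\<theta>/2)} = {}" using lt[of "tan a"] at by auto
    then show ?thesis using False \<delta> by (auto simp: trunc_power_def)
  next
    case True
    let ?F = "\<lambda>t. - (pi / 6 * ?x t powr \<delta>)"
    have "(\<integral>\<^sup>+t. ennreal (?f t) * indicator {tan a<..<tan (\<theta>/2)} t \<partial>lborel) = ennreal (?F (tan (\<theta>/2)) - ?F (tan a))"
    proof (rule nn_integral_lborel_FTC)
      show "tan a \<le> tan (\<theta>/2)" using True lt[of "tan a"] at by simp
      have "0 \<le> ?x t" if "t \<le> tan (\<theta>/2)" for t
        using that arctan_le_iff[of t "tan (\<theta>/2)"] at by simp
      then show "continuous_on {tan a..tan (\<theta>/2)} ?F"
        using \<delta> by (intro continuous_on_minus continuous_on_mult continuous_on_const continuous_on_powr' continuous_on_diff continuous_on_arctan continuous_on_id) auto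
      fix t assume "t \<in> {tan a<..<tan (\<theta>/2)}"
      then have x: "0 < ?x t" using lt[of t] by auto
      have "(?x has_real_derivative - 2 * inverse (1 + t\<^sup>2)) (at t)"
        by (auto intro!: derivative_eq_intros)
      from DERIV_minus[OF DERIV_cmult[OF DERIV_fun_powr[OF this x, of \<delta>], of "pi / 6"]]
      show "(?F has_real_derivative ?f t) (at t)" by (simp add: inverse_eq_divide mult_ac)
      show "0 \<le> ?f t" using \<delta> by simp
    qed
    then show ?thesis using True \<delta> at by (simp add: trunc_power_def)
  qed
  finally show ?thesis .
qed

section \<open>Monotonicity of the profile\<close>

lemma cos_ge_one_minus_half_square: "1 - y\<^sup>2 / 2 \<le> cos (y::real)"
proof -
  have "(sin (y / 2))\<^sup>2 \<le> (y / 2)\<^sup>2"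
    using abs_le_square_iff[of "sin (y / 2)" "y / 2"] abs_sin_x_le_abs_x by blast
  then show ?thesis using cos_double_sin[of "y / 2"] by (simp add: power_divide)
qed

lemma inverse_minus_cot_le:
  fixes y :: real
  assumes "0 < y" "y < 1"
  shows "1 / y - cos y / sin y \<le> y"
proof -
  have s: "0 < sin y" using assms pi_gt3 by (intro sin_gt_zero) auto
  have y2: "y\<^sup>2 < 1" using assms by (simp add: abs_square_less_1)
  have "(1 - y\<^sup>2) * sin y \<le> (1 - y\<^sup>2) * y"
    using y2 assms by (intro mult_left_mono sin_x_le_x) auto
  also have "\<dots> \<le> y * (1 - y\<^sup>2 / 2)"
    using assms by (simp add: algebra_simps)
  also have "\<dots> \<le> y * cos y"
    using assms cos_ge_one_minus_half_square by (intro mult_left_mono) auto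
  finally show ?thesis using assms s by (simp add: field_simps power2_eq_square)
qed

text \<open>
  The derivative at \<open>u\<close> is a sum of \<open>- (\<delta> - 2) / (k - u) - cot (k - u) / 2\<close>, of \<open>cot (k + u) / 2 - cot u\<close> and
  of a bounded term. As \<open>\<delta> \<ge> 3 / 2\<close>, the first part is at most \<open>(1 / (k - u) - cot (k - u)) / 2\<close>, in which the
  poles at \<open>u = k\<close> cancel, and the second part is at most \<open>- cot u / 2\<close>, which is at most \<open>- 31 / 16\<close> for
  \<open>u < 1 / 4\<close>.
\<close>

lemma log_scaled_tail_density_decreasing:
  fixes k \<delta> a b :: real
  defines "L \<equiv> \<lambda>b. (\<delta> - 2) * ln (2 * (k - b)) + ln (sin (k - b)) / 2 + ln (sin (k + b)) / 2
    + ln (2 * (\<delta> - 1) + 2 * (k - b) * tan b) - ln (sin b)"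
  assumes k: "k \<le> 1 / 4" and \<delta>: "3 / 2 \<le> \<delta>" and ab: "0 < a" "a < b" "b < k"
  shows "L b < L a"
proof (rule DERIV_neg_imp_decreasing[OF ab(2)])
  fix u assume "a \<le> u" "u \<le> b"
  then have u: "0 < u" "u < k" "u < 1/4" using ab k by auto
  define y where "y = k - u"
  have y: "0 < y" "y < 1/4" using u k by (auto simp: y_def)
  have pi4: "3 < pi" by (rule pi_gt3)
  have sn: "0 < sin u" "0 < sin (k - u)" "0 < sin (k + u)" "0 < cos (k + u)"
    using u k pi4 by (auto intro!: sin_gt_zero cos_gt_zero)
  have u2: "u\<^sup>2 \<le> 1/16" using power_mono[of u "1/4" 2] u by (simp add: power_divide)
  have cu: "31/32 \<le> cos u" using cos_ge_one_minus_half_square[of u] u2 by linarith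
  have cu2: "1/2 \<le> (cos u)\<^sup>2" using power_mono[OF cu, of 2] by (simp add: power_divide)
  have tu: "0 < tan u" using sn cu by (simp add: tan_def)
  define P where "P = 2 * (\<delta> - 1) + 2 * (k - u) * tan u"
  have "0 \<le> 2 * (k - u) * tan u" using u tu by (intro mult_nonneg_nonneg) auto
  then have P: "1 \<le> P" unfolding P_def using \<delta> by argo
  let ?D = "(\<delta> - 2) * (- 2 / (2 * (k - u))) + (- cos (k - u) / sin (k - u)) / 2 + (cos (k + u) / sin (k + u)) / 2
     + (2 * (k - u) * inverse ((cos u)\<^sup>2) - 2 * tan u) / P - cos u / sin u"
  have d1: "((\<lambda>b. ln (2 * (k - b))) has_real_derivative - 2 / (2 * (k - u))) (at u)"
    using u by (auto intro!: derivative_eq_intros)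
  have d2: "((\<lambda>b. ln (sin (k - b))) has_real_derivative - cos (k - u) / sin (k - u)) (at u)"
    using sn by (auto intro!: derivative_eq_intros)
  have d3: "((\<lambda>b. ln (sin (k + b))) has_real_derivative cos (k + u) / sin (k + u)) (at u)"
    using sn by (auto intro!: derivative_eq_intros)
  have dP: "((\<lambda>b. 2 * (\<delta> - 1) + 2 * (k - b) * tan b) has_real_derivative 2 * (k - u) * inverse ((cos u)\<^sup>2) - 2 * tan u) (at u)"
    using cu by (auto intro!: derivative_eq_intros)
  have "0 < 2 * (\<delta> - 1) + 2 * (k - u) * tan u"
    using P unfolding P_def by (rule less_le_trans[OF zero_less_one])
  from DERIV_chain2[OF DERIV_ln_divide[OF this] dP]
  have d4: "((\<lambda>b. ln (2 * (\<delta> - 1) + 2 * (k - b) * tan b)) has_real_derivative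
      (2 * (k - u) * inverse ((cos u)\<^sup>2) - 2 * tan u) / P) (at u)"
    unfolding P_def by (simp only: times_divide_eq_left mult_1)
  have d5: "((\<lambda>b. ln (sin b)) has_real_derivative cos u / sin u) (at u)"
    using sn by (auto intro!: derivative_eq_intros)
  have D: "(L has_real_derivative ?D) (at u)"
    unfolding L_def by (intro DERIV_add DERIV_diff DERIV_cdivide DERIV_cmult d1 d2 d3 d4 d5)
  have "?D < 0"
  proof -
    have "(\<delta> - 2) * (- 2 / (2 * (k - u))) = (2 - \<delta>) * (1 / y)"
      using y by (simp add: y_def field_simps)
    also have "\<dots> \<le> 1/2 * (1 / y)" using \<delta> y by (intro mult_right_mono) auto
    finally have b0: "(\<delta> - 2) * (- 2 / (2 * (k - u))) \<le> 1/2 * (1 / y)" .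
    have b1: "(\<delta> - 2) * (- 2 / (2 * (k - u))) + (- cos (k - u) / sin (k - u)) / 2 \<le> y / 2"
    proof -
      have "A + - C / S / 2 \<le> y / 2" if "A \<le> 1/2 * (1 / y)" "1 / y - C / S \<le> y" for A C S :: real
        using that by simp
      from this[OF b0] show ?thesis
        using inverse_minus_cot_le[of y] y unfolding y_def by simp
    qed
    have b2: "cos (k + u) / sin (k + u) \<le> cos u / sin u"
    proof (rule frac_le)
      show "cos (k + u) \<le> cos u" using u k pi4 by (intro cos_monotone_0_pi_le) auto
      show "sin u \<le> sin (k + u)" using u k pi4 by (intro sin_monotone_2pi_le) auto
    qed (use sn cu in auto)
    have "inverse ((cos u)\<^sup>2) \<le> 2" using le_imp_inverse_le[OF cu2] by simp
    then have "2 * (k - u) * inverse ((cos u)\<^sup>2) \<le> (2 * (1/4)) * 2"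
      using y unfolding y_def[symmetric] by (intro mult_mono) auto
    then have n: "2 * (k - u) * inverse ((cos u)\<^sup>2) - 2 * tan u \<le> 1" using tu by simp
    have b3: "(2 * (k - u) * inverse ((cos u)\<^sup>2) - 2 * tan u) / P \<le> 1"
      using n P by (simp add: divide_le_eq)
    have "sin u \<le> 1/4" using sin_x_le_x[of u] u by simp
    then have b4: "31/8 \<le> cos u / sin u" using cu sn by (simp add: le_divide_eq)
    have "A + C / 2 + E / 2 + F - G < 0"
      if "A + C / 2 \<le> y / 2" "E \<le> G" "F \<le> 1" "31/8 \<le> G" for A C E F G :: real
      using that y by linarith
    from this[OF b1 b2 b3 b4] show ?thesis .
  qed
  with D show "\<exists>D. (L has_real_derivative D) (at u) \<and> D < 0" by blast
qed

text \<open>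
  With \<open>s = (sin b)\<^sup>2\<close> and \<open>\<theta> = 2 k\<close>, the weight factors completely, since
  \<open>(sin k)\<^sup>2 - (sin b)\<^sup>2 = sin (k - b) * sin (k + b)\<close>.
\<close>

lemma scaled_tail_density_eq_exp:
  assumes \<delta>: "3 / 2 \<le> \<delta>" and b: "0 < b" "b < k" and k: "k \<le> 1 / 4"
  shows "sqrt ((sin k)\<^sup>2 - (sin b)\<^sup>2) * tail_density (2 * k) \<delta> ((sin b)\<^sup>2)
    = \<delta> / 2 * exp ((\<delta> - 2) * ln (2 * (k - b)) + ln (sin (k - b)) / 2 + ln (sin (k + b)) / 2
    + ln (2 * (\<delta> - 1) + 2 * (k - b) * tan b) - ln (sin b))"
proof -
  have pi4: "3 < pi" by (rule pi_gt3)
  have sn: "0 < sin b" "0 < sin (k - b)" "0 < sin (k + b)" "0 < cos b"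
    using b k pi4 by (auto intro!: sin_gt_zero cos_gt_zero)
  define X where "X = (2 * (k - b)) powr (\<delta> - 2)"
  have half: "exp (ln v / 2) = sqrt v" if "0 < v" for v :: real
    using that by (simp add: ln_sqrt[symmetric])
  define P where "P = 2 * (\<delta> - 1) + 2 * (k - b) * tan b"
  have "0 < tan b" using sn by (simp add: tan_def)
  then have P: "0 < P" unfolding P_def using \<delta> b by (intro add_pos_nonneg) auto
  have E: "exp ((\<delta> - 2) * ln (2 * (k - b)) + ln (sin (k - b)) / 2 + ln (sin (k + b)) / 2
    + ln P - ln (sin b)) = X * sqrt (sin (k - b)) * sqrt (sin (k + b)) * P / sin b"
    using sn b P by (simp add: exp_add exp_diff half X_def powr_def)
  have "(sin k)\<^sup>2 - (sin b)\<^sup>2 = sin (k - b) * sin (k + b)"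
  proof -
    have "sin (k - b) * sin (k + b) = (sin k)\<^sup>2 * (cos b)\<^sup>2 - (cos k)\<^sup>2 * (sin b)\<^sup>2"
      by (simp add: sin_add sin_diff algebra_simps power2_eq_square)
    then show ?thesis by (simp add: cos_squared_eq algebra_simps)
  qed
  then have R: "sqrt ((sin k)\<^sup>2 - (sin b)\<^sup>2) = sqrt (sin (k - b)) * sqrt (sin (k + b))"
    by (simp add: real_sqrt_mult)
  have C: "sqrt (1 - (sin b)\<^sup>2) = cos b" using sn by (simp add: cos_squared_eq[symmetric])
  have S: "sqrt ((sin b)\<^sup>2) = sin b" using sn by simp
  have A: "arcsin (sin b) = b" using b k pi4 by (intro arcsin_sin) auto
  have X1: "(2 * k - 2 * b) powr (\<delta> - 1) = X * (2 * (k - b))"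
    using powr_add[of "2 * (k - b)" "\<delta> - 2" 1] b by (simp add: X_def algebra_simps)
  have "tail_density (2 * k) \<delta> ((sin b)\<^sup>2) = \<delta> * ((\<delta> - 1) * X / sin b + X * (2 * (k - b)) / (2 * cos b))"
    unfolding tail_density_def C S A X1 by (simp add: X_def algebra_simps)
  also have "\<dots> = \<delta> / 2 * (X * P / sin b)"
    using sn by (simp add: P_def tan_def field_simps)
  finally show ?thesis unfolding R E[unfolded P_def] by (simp add: P_def mult_ac)
qed

lemma scaled_tail_density_strict_decreasing:
  assumes \<theta>: "0 < \<theta>" "\<theta> \<le> 1 / 2" and \<delta>: "3 / 2 \<le> \<delta>"
    and s: "0 < s" "s < s'" "s' < (sin (\<theta> / 2))\<^sup>2"
  shows "sqrt ((sin (\<theta> / 2))\<^sup>2 - s') * tail_density \<theta> \<delta> s' < sqrt ((sin (\<theta> / 2))\<^sup>2 - s) * tail_density \<theta> \<delta> s"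
proof -
  have k: "0 \<le> \<theta> / 2" "\<theta> / 2 \<le> pi / 2" "\<theta> / 2 \<le> 1 / 4" using \<theta> pi_gt3 by auto
  let ?b = "\<lambda>s. arcsin (sqrt s)"
  have b: "0 < ?b s" "?b s < \<theta>/2" "(sin (?b s))\<^sup>2 = s"
    using arcsin_sqrt_bounds[of s "\<theta>/2"] s k by auto
  have b': "0 < ?b s'" "?b s' < \<theta>/2" "(sin (?b s'))\<^sup>2 = s'"
    using arcsin_sqrt_bounds[of s' "\<theta>/2"] s k by auto
  have "?b s < ?b s'"
    using sin_squared_less_iff[of "?b s" "?b s'"] b b' k s by auto
  note log_scaled_tail_density_decreasing[OF k(3) \<delta> b(1) this b'(2)]
  moreover have "\<delta> / 2 * exp u < \<delta> / 2 * exp v" if "u < v" for u v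
    using that \<delta> by simp
  ultimately show ?thesis
    using scaled_tail_density_eq_exp[OF \<delta> b(1,2) k(3)] scaled_tail_density_eq_exp[OF \<delta> b'(1,2) k(3)]
    unfolding b(3) b'(3) by (metis mult_2 field_sum_of_halves)
qed

text \<open>
  The substitution \<open>s = w + (T - w) v\<close> moves the dependence on \<open>w\<close> out of the singular kernel: only the
  point at which the scaled density is evaluated still depends on it.
\<close>

lemma abel_transform_tail_weight_eq:
  assumes w: "0 \<le> w" "w < (sin (\<theta> / 2))\<^sup>2" and \<delta>: "1 \<le> \<delta>"
  defines "T \<equiv> (sin (\<theta> / 2))\<^sup>2"
  shows "abel_transform (tail_weight \<theta> \<delta>) w
    = (\<integral>\<^sup>+v. ennreal (sqrt (T - (w + (T - w) * v)) * tail_density \<theta> \<delta> (w + (T - w) * v) / sqrt (v * (1 - v)))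
        * indicator {0<..<1} v \<partial>lborel)"
proof -
  have T1: "T \<le> 1" unfolding T_def by (simp add: abs_square_le_1)
  have c: "0 < T - w" using w T_def by simp
  have "abel_transform (tail_weight \<theta> \<delta>) w = ennreal (T - w) *
    (\<integral>\<^sup>+v. tail_weight \<theta> \<delta> (w + (T - w) * v) * ennreal (1 / sqrt ((w + (T - w) * v) - w)) * indicator {w<..} (w + (T - w) * v) \<partial>lborel)"
    unfolding abel_transform_def using c
    by (subst nn_integral_real_affine[where c="T - w" and t=w]) simp_all
  also have "\<dots> = (\<integral>\<^sup>+v. ennreal (T - w) * (tail_weight \<theta> \<delta> (w + (T - w) * v) * ennreal (1 / sqrt ((w + (T - w) * v) - w)) * indicator {w<..} (w + (T - w) * v)) \<partial>lborel)"
    by (intro nn_integral_cmult[symmetric]) measurable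
  also have "\<dots> = (\<integral>\<^sup>+v. ennreal (sqrt (T - (w + (T - w) * v)) * tail_density \<theta> \<delta> (w + (T - w) * v) / sqrt (v * (1 - v)))
        * indicator {0<..<1} v \<partial>lborel)"
  proof (intro nn_integral_cong)
    fix v :: real
    let ?s = "w + (T - w) * v"
    have i1: "?s < T \<longleftrightarrow> v < 1"
    proof -
      have "T - ?s = (T - w) * (1 - v)" by (simp add: algebra_simps)
      then show ?thesis using c by (metis diff_gt_0_iff_gt zero_less_mult_pos mult_pos_pos)
    qed
    have i2: "w < ?s \<longleftrightarrow> 0 < v" using c by (simp add: zero_less_mult_iff)
    show "ennreal (T - w) * (tail_weight \<theta> \<delta> ?s * ennreal (1 / sqrt (?s - w)) * indicator {w<..} ?s)
      = ennreal (sqrt (T - ?s) * tail_density \<theta> \<delta> ?s / sqrt (v * (1 - v))) * indicator {0<..<1} v"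
    proof (cases "0 < v \<and> v < 1")
      case True
      then have s: "0 < ?s" "?s < T" using i1 i2 w by auto
      have d: "0 \<le> tail_density \<theta> \<delta> ?s" using s T1 \<delta> by (intro tail_density_nonneg) auto
      have e: "T - ?s = (T - w) * (1 - v)" by (simp add: algebra_simps)
      have q: "(T - w) / sqrt (T - w) = sqrt (T - w)" using c by (simp add: real_div_sqrt)
      have "(T - w) * (tail_density \<theta> \<delta> ?s * (1 / sqrt (?s - w))) = (T - w) / sqrt (T - w) * tail_density \<theta> \<delta> ?s / sqrt v"
        by (simp add: real_sqrt_mult)
      also have "\<dots> = sqrt (T - ?s) * tail_density \<theta> \<delta> ?s / sqrt (v * (1 - v))"
        unfolding e q using True by (simp add: real_sqrt_mult)
      finally show ?thesis using True s c d i2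
        by (simp add: tail_weight_def T_def[symmetric] flip: ennreal_mult')
    next
      case False
      then show ?thesis using i1 i2 by (auto simp: tail_weight_def T_def[symmetric] indicator_def)
    qed
  qed
  finally show ?thesis .
qed

lemma nn_integral_arcsine_density:
  "(\<integral>\<^sup>+v. ennreal (1 / sqrt (v * (1 - v))) * indicator {0<..<1} v \<partial>lborel) = ennreal pi"
proof -
  have "(\<integral>\<^sup>+v. ennreal (1 / sqrt (v * (1 - v))) * indicator {0<..<1} v \<partial>lborel)
    = ennreal (arcsin (2 * 1 - 1) - arcsin (2 * 0 - 1))"
  proof (rule nn_integral_lborel_FTC)
    show "continuous_on {0..1} (\<lambda>v::real. arcsin (2 * v - 1))"
      by (intro continuous_intros) auto
    fix v :: real assume v: "v \<in> {0<..<1}"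
    have "((\<lambda>v. 2 * v - 1) has_real_derivative 2) (at v)" by (auto intro!: derivative_eq_intros)
    then have "((\<lambda>v. arcsin (2 * v - 1)) has_real_derivative inverse (sqrt (1 - (2 * v - 1)\<^sup>2)) * 2) (at v)"
      using v by (intro DERIV_chain2[OF DERIV_arcsin]) auto
    moreover have "1 - (2 * v - 1)\<^sup>2 = 2\<^sup>2 * (v * (1 - v))" by (simp add: algebra_simps power2_eq_square)
    ultimately show "((\<lambda>v. arcsin (2 * v - 1)) has_real_derivative 1 / sqrt (v * (1 - v))) (at v)"
      by (simp only: real_sqrt_mult) (simp add: inverse_eq_divide)
    show "0 \<le> 1 / sqrt (v * (1 - v))" using v by simp
  qed simp
  then show ?thesis by (simp add: arcsin_minus_1)
qed

text \<open>
  The scaled density is at most its value at \<open>w\<close>, and the arcsine density has total mass \<open>\<pi>\<close>. At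
  \<open>w = 0\<close> the transform is infinite, because the scaled density grows like \<open>1 / sqrt s\<close> there.
\<close>

lemma abel_transform_tail_weight_finite:
  assumes \<theta>: "0 < \<theta>" "\<theta> \<le> 1 / 2" and \<delta>: "3 / 2 \<le> \<delta>" and w: "0 < w"
  shows "abel_transform (tail_weight \<theta> \<delta>) w < \<infinity>"
proof (cases "w < (sin (\<theta> / 2))\<^sup>2")
  case False
  then have "abel_transform (tail_weight \<theta> \<delta>) w = (\<integral>\<^sup>+s. 0 \<partial>(lborel :: real measure))"
    unfolding abel_transform_def by (intro nn_integral_cong) (auto simp: tail_weight_def indicator_def)
  then show ?thesis by simp
next
  case True
  let ?T = "(sin (\<theta> / 2))\<^sup>2"
  let ?W = "\<lambda>s. sqrt (?T - s) * tail_density \<theta> \<delta> s"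
  have T1: "?T \<le> 1" by (simp add: abs_square_le_1)
  have W0: "0 \<le> ?W w" using True w T1 \<delta> by (intro mult_nonneg_nonneg tail_density_nonneg) auto
  have le: "?W (w + (?T - w) * v) \<le> ?W w" if "0 < v" "v < 1" for v
  proof -
    have "w < w + (?T - w) * v" using that True by simp
    moreover have "(?T - w) * v < (?T - w) * 1" using that True by (intro mult_strict_left_mono) auto
    then have "w + (?T - w) * v < ?T" by simp
    ultimately show ?thesis using scaled_tail_density_strict_decreasing[OF \<theta> \<delta> w] by (simp add: less_imp_le)
  qed
  have "abel_transform (tail_weight \<theta> \<delta>) w
    \<le> (\<integral>\<^sup>+v. ennreal (?W w) * (ennreal (1 / sqrt (v * (1 - v))) * indicator {0<..<1} v) \<partial>lborel)"
    using True w \<delta>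
  proof (subst abel_transform_tail_weight_eq, simp_all only: less_imp_le, simp, intro nn_integral_mono)
    fix v :: real
    show "ennreal (?W (w + (?T - w) * v) / sqrt (v * (1 - v))) * indicator {0<..<1} v
      \<le> ennreal (?W w) * (ennreal (1 / sqrt (v * (1 - v))) * indicator {0<..<1} v)"
    proof (cases "0 < v \<and> v < 1")
      case True
      then have "?W (w + (?T - w) * v) / sqrt (v * (1 - v)) \<le> ?W w * (1 / sqrt (v * (1 - v)))"
        using le[of v] by (simp add: divide_right_mono)
      then show ?thesis using True W0 by (simp add: ennreal_leI flip: ennreal_mult')
    qed simp
  qed
  also have "\<dots> = ennreal (?W w) * ennreal pi"
    by (subst nn_integral_cmult) (simp_all only: nn_integral_arcsine_density, measurable)
  also have "\<dots> < \<infinity>" by (simp add: ennreal_mult_less_top)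
  finally show ?thesis .
qed

text \<open>
  For each \<open>v\<close> in \<open>(0, 1)\<close> the point \<open>w + (T - w) v\<close> increases strictly with \<open>w\<close>, so the integrand
  decreases strictly.
\<close>

lemma abel_transform_tail_weight_strict:
  assumes \<theta>: "0 < \<theta>" "\<theta> \<le> 1 / 2" and \<delta>: "3 / 2 \<le> \<delta>"
    and w: "0 \<le> w" "w < w'" "w' < (sin (\<theta> / 2))\<^sup>2"
  shows "abel_transform (tail_weight \<theta> \<delta>) w' < abel_transform (tail_weight \<theta> \<delta>) w"
proof -
  let ?T = "(sin (\<theta> / 2))\<^sup>2"
  let ?W = "\<lambda>s. sqrt (?T - s) * tail_density \<theta> \<delta> s"
  let ?I = "\<lambda>w v. ennreal (?W (w + (?T - w) * v) / sqrt (v * (1 - v))) * indicator {0<..<1} v"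
  have T1: "?T \<le> 1" by (simp add: abs_square_le_1)
  have \<delta>1: "1 \<le> \<delta>" using \<delta> by simp
  have eq: "abel_transform (tail_weight \<theta> \<delta>) u = (\<integral>\<^sup>+v. ?I u v \<partial>lborel)" if "0 \<le> u" "u < ?T" for u
    using abel_transform_tail_weight_eq[OF that \<delta>1] .
  have less: "?I w' v < ?I w v" if v: "0 < v" "v < 1" for v
  proof -
    have "0 < w + (?T - w) * v" using v w by (intro add_nonneg_pos) auto
    moreover have "w + (?T - w) * v < w' + (?T - w') * v"
    proof -
      have "w' + (?T - w') * v - (w + (?T - w) * v) = (w' - w) * (1 - v)" by (simp add: algebra_simps)
      moreover have "0 < (w' - w) * (1 - v)" using v w by simp
      ultimately show ?thesis by linarith
    qed
    moreover have "w' + (?T - w') * v < ?T"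
    proof -
      have "?T - (w' + (?T - w') * v) = (?T - w') * (1 - v)" by (simp add: algebra_simps)
      moreover have "0 < (?T - w') * (1 - v)" using v w by simp
      ultimately show ?thesis by linarith
    qed
    ultimately have s: "?W (w' + (?T - w') * v) < ?W (w + (?T - w) * v)"
      and p: "0 < w' + (?T - w') * v" "w' + (?T - w') * v < ?T"
      using scaled_tail_density_strict_decreasing[OF \<theta> \<delta>] by auto
    have "0 \<le> ?W (w' + (?T - w') * v)"
      using p T1 \<delta>1 by (intro mult_nonneg_nonneg tail_density_nonneg) auto
    then show ?thesis using s v
      by (simp add: ennreal_less_iff divide_strict_right_mono)
  qed
  have meas: "?I u \<in> borel_measurable lborel" if "0 \<le> u" "u < ?T" for u
  proof -
    have "(\<lambda>v. tail_weight \<theta> \<delta> (u + (?T - u) * v) * ennreal (sqrt (?T - (u + (?T - u) * v)) / sqrt (v * (1 - v))) * indicator {0<..<1} v)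
       \<in> borel_measurable lborel" by measurable
    also have "(\<lambda>v. tail_weight \<theta> \<delta> (u + (?T - u) * v) * ennreal (sqrt (?T - (u + (?T - u) * v)) / sqrt (v * (1 - v))) * indicator {0<..<1} v) = ?I u"
    proof
      fix v :: real
      show "tail_weight \<theta> \<delta> (u + (?T - u) * v) * ennreal (sqrt (?T - (u + (?T - u) * v)) / sqrt (v * (1 - v))) * indicator {0<..<1} v = ?I u v"
      proof (cases "0 < v \<and> v < 1")
        case True
        have p: "0 < u + (?T - u) * v" using True that by (intro add_nonneg_pos) auto
        have "?T - (u + (?T - u) * v) = (?T - u) * (1 - v)" by (simp add: algebra_simps)
        moreover have "0 < (?T - u) * (1 - v)" using True that by simp
        ultimately have q: "u + (?T - u) * v < ?T" by linarith
        have "0 \<le> tail_density \<theta> \<delta> (u + (?T - u) * v)"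
          using p q T1 \<delta>1 by (intro tail_density_nonneg) auto
        then show ?thesis using True p q
          by (simp add: tail_weight_def mult.commute flip: ennreal_mult')
      qed simp
    qed
    finally show ?thesis .
  qed
  have w': "0 \<le> w'" "w < ?T" using w by auto
  have "(\<integral>\<^sup>+v. ?I w' v \<partial>lborel) < (\<integral>\<^sup>+v. ?I w v \<partial>lborel)"
  proof (rule nn_integral_less)
    show "(\<integral>\<^sup>+v. ?I w' v \<partial>lborel) \<noteq> \<infinity>"
      using abel_transform_tail_weight_finite[OF \<theta> \<delta>, of w'] eq[OF w'(1) w(3)] w by auto
    show "AE v in lborel. ?I w' v \<le> ?I w v"
      using less by (intro AE_I2) (force simp: indicator_def intro: less_imp_le)
    show "\<not> (AE v in lborel. ?I w v \<le> ?I w' v)"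
    proof
      assume "AE v in lborel. ?I w v \<le> ?I w' v"
      then have "AE v in lborel. v \<notin> {0<..<1::real}"
      proof eventually_elim
        case (elim v)
        then show ?case using less[of v] by (metis greaterThanLessThan_iff leD)
      qed
      then have "{0<..<1::real} \<in> null_sets lborel"
        by (subst AE_iff_null_sets) auto
      then show False by (simp add: null_sets_def)
    qed
  qed (use meas w w' in auto)
  then show ?thesis using eq w w' by simp
qed

lemma abel_transform_tail_weight_less:
  assumes \<theta>: "0 < \<theta>" "\<theta> \<le> 1 / 2" and \<delta>: "3 / 2 \<le> \<delta>"
    and w: "0 \<le> w" "w < w'" "w < (sin (\<theta> / 2))\<^sup>2"
  shows "abel_transform (tail_weight \<theta> \<delta>) w' < abel_transform (tail_weight \<theta> \<delta>) w"
proof (cases "w' < (sin (\<theta> / 2))\<^sup>2")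
  case True
  then show ?thesis using abel_transform_tail_weight_strict[OF \<theta> \<delta>] w by blast
next
  case False
  then have "abel_transform (tail_weight \<theta> \<delta>) w' = (\<integral>\<^sup>+s. 0 \<partial>(lborel :: real measure))"
    unfolding abel_transform_def by (intro nn_integral_cong) (auto simp: tail_weight_def indicator_def)
  also have "\<dots> \<le> abel_transform (tail_weight \<theta> \<delta>) ((w + (sin (\<theta> / 2))\<^sup>2) / 2)" by simp
  also have "\<dots> < abel_transform (tail_weight \<theta> \<delta>) w"
    using w by (intro abel_transform_tail_weight_strict \<theta> \<delta>) auto
  finally show ?thesis .
qed

lemma abel_transform_tail_weight_antimono:
  assumes \<theta>: "0 < \<theta>" "\<theta> \<le> 1 / 2" and \<delta>: "3 / 2 \<le> \<delta>" and w: "0 \<le> w" "w \<le> w'"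
  shows "abel_transform (tail_weight \<theta> \<delta>) w' \<le> abel_transform (tail_weight \<theta> \<delta>) w"
proof (cases "w < (sin (\<theta> / 2))\<^sup>2 \<and> w \<noteq> w'")
  case True
  then show ?thesis using abel_transform_tail_weight_less[OF \<theta> \<delta> w(1), of w'] w by simp
next
  case False
  have "abel_transform (tail_weight \<theta> \<delta>) w' = (\<integral>\<^sup>+s. 0 \<partial>(lborel :: real measure))" if "w \<noteq> w'"
    unfolding abel_transform_def using that False w
    by (intro nn_integral_cong) (auto simp: tail_weight_def indicator_def)
  then show ?thesis by (cases "w = w'") auto
qed

section \<open>Minimum matrices\<close>

text \<open>
  Subtract the smallest entry \<open>a k\<close> from all others: this splits off \<open>a k\<close> times a square and leaves
  a minimum matrix in which the row and the column of \<open>k\<close> vanish.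
\<close>

lemma sum_min_nonneg:
  fixes a c :: "'i \<Rightarrow> real"
  assumes "finite S" "\<And>i. i \<in> S \<Longrightarrow> 0 \<le> a i"
  shows "0 \<le> (\<Sum>i\<in>S. \<Sum>j\<in>S. c i * c j * min (a i) (a j))"
  using assms
proof (induction S arbitrary: a rule: finite_psubset_induct)
  case (psubset S)
  show ?case
  proof (cases "S = {}")
    case False
    then obtain k where k: "k \<in> S" "\<And>i. i \<in> S \<Longrightarrow> a k \<le> a i"
      using psubset.hyps by (metis (mono_tags) arg_min_if_finite(1) arg_min_least)
    let ?b = "\<lambda>i. a i - a k"
    have eq: "c i * c j * min (a i) (a j) = a k * (c i * c j) + c i * c j * min (?b i) (?b j)" for i j
      by (simp add: min_def algebra_simps)
    have "(\<Sum>i\<in>S. \<Sum>j\<in>S. c i * c j * min (a i) (a j))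
      = a k * (\<Sum>i\<in>S. c i)\<^sup>2 + (\<Sum>i\<in>S. \<Sum>j\<in>S. c i * c j * min (?b i) (?b j))"
      by (simp only: eq sum.distrib power2_eq_square sum_product) (simp add: sum_distrib_left)
    also have "(\<Sum>i\<in>S. \<Sum>j\<in>S. c i * c j * min (?b i) (?b j)) = (\<Sum>i\<in>S-{k}. \<Sum>j\<in>S-{k}. c i * c j * min (?b i) (?b j))"
      using psubset.hyps k by (intro sum.mono_neutral_cong_right) (auto intro!: sum.mono_neutral_right sum.neutral simp: min_absorb1 min_absorb2)
    finally show ?thesis
      using psubset.IH[of "S - {k}" ?b] psubset.prems[OF k(1)] k
      by (auto intro!: add_nonneg_nonneg)
  qed simp
qed

text \<open>
  If at most one entry exceeds the level \<open>M\<close>, then cutting all entries at \<open>M\<close> changes the matrix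
  only on the diagonal, by the excesses over \<open>M\<close>. The cut matrix is again a minimum matrix.
\<close>

lemma sum_min_ge_excess:
  fixes a c :: "'i \<Rightarrow> real"
  assumes S: "finite S" and a: "\<And>i. i \<in> S \<Longrightarrow> 0 \<le> a i" and M: "0 \<le> M"
    and one: "\<And>i j. i \<in> S \<Longrightarrow> j \<in> S \<Longrightarrow> M < a i \<Longrightarrow> M < a j \<Longrightarrow> i = j"
    and k: "k \<in> S"
  shows "(c k)\<^sup>2 * max 0 (a k - M) \<le> (\<Sum>i\<in>S. \<Sum>j\<in>S. c i * c j * min (a i) (a j))"
proof -
  let ?b = "\<lambda>i. min (a i) M" and ?d = "\<lambda>i. (c i)\<^sup>2 * max 0 (a i - M)"
  have "c i * c j * min (a i) (a j) = c i * c j * min (?b i) (?b j) + (if i = j then ?d i else 0)"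
    if "i \<in> S" "j \<in> S" for i j
  proof (cases "i = j")
    case True
    have "a i = ?b i + max 0 (a i - M)" by simp
    then have "c i * c i * a i = c i * c i * ?b i + c i * c i * max 0 (a i - M)"
      by (metis distrib_left)
    then show ?thesis using True by (simp add: power2_eq_square)
  next
    case False
    then have "a i \<le> M \<or> a j \<le> M" using one[OF that] by force
    then have "min (a i) (a j) = min (?b i) (?b j)" by auto
    then show ?thesis using False by simp
  qed
  then have "(\<Sum>i\<in>S. \<Sum>j\<in>S. c i * c j * min (a i) (a j))
    = (\<Sum>i\<in>S. \<Sum>j\<in>S. c i * c j * min (?b i) (?b j)) + (\<Sum>i\<in>S. ?d i)"
    using S by (simp add: sum.distrib cong: sum.cong)
  moreover have "0 \<le> (\<Sum>i\<in>S. \<Sum>j\<in>S. c i * c j * min (?b i) (?b j))"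
    using a M by (intro sum_min_nonneg S) simp
  moreover have "?d k \<le> (\<Sum>i\<in>S. ?d i)"
    using S k by (intro member_le_sum) auto
  ultimately show ?thesis by linarith
qed

section \<open>Truncated powers on the sphere\<close>

text \<open>
  The function \<open>h\<^sub>x\<close> of the introduction. It takes extended values because it is infinite on the
  axis through \<open>x\<close>, a null set.
\<close>

definition bump :: "real \<Rightarrow> real \<Rightarrow> real^3 \<Rightarrow> real^3 \<Rightarrow> ennreal" where
  "bump \<theta> \<delta> x z = abel_transform (tail_weight \<theta> \<delta>) (1 - (z \<bullet> x / norm z)\<^sup>2)
     * indicator {z. norm z \<le> 1 \<and> 0 < z \<bullet> x} z"

lemma borel_measurable_bump [measurable]: "bump \<theta> \<delta> x \<in> borel_measurable borel"
proof -
  have "{z::real^3. norm z \<le> 1} \<in> sets borel" "{z::real^3. 0 < z \<bullet> x} \<in> sets borel"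
    by (auto intro!: borel_closed borel_open closed_Collect_le open_Collect_less continuous_intros)
  then have [measurable]: "{z::real^3. norm z \<le> 1 \<and> 0 < z \<bullet> x} \<in> sets borel"
    by (simp add: Collect_conj_eq sets.Int)
  show ?thesis unfolding bump_def[abs_def] by measurable
qed

lemma sphere_frame:
  fixes x y :: "real^3"
  assumes "norm x = 1" "norm y = 1"
  obtains e where "norm e = 1" "x \<bullet> e = 0"
    "y = cos (geodesic_dist x y) *\<^sub>R x + sin (geodesic_dist x y) *\<^sub>R e"
proof -
  define t where "t = geodesic_dist x y"
  have xy: "\<bar>x \<bullet> y\<bar> \<le> 1" using Cauchy_Schwarz_ineq2[of x y] assms by simp
  have c: "cos t = x \<bullet> y" using xy by (simp add: t_def geodesic_dist_def abs_le_iff cos_arccos)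
  define v where "v = y - cos t *\<^sub>R x"
  have xv: "x \<bullet> v = 0" using assms by (simp add: v_def inner_diff_right c norm_eq_1)
  have "v \<bullet> v = 1 - (cos t)\<^sup>2"
    using assms by (simp add: v_def inner_diff_left inner_diff_right c norm_eq_1 power2_eq_square inner_commute)
  then have nv: "(norm v)\<^sup>2 = (sin t)\<^sup>2" by (simp add: power2_norm_eq_inner sin_squared_eq)
  have s0: "0 \<le> sin t" unfolding t_def geodesic_dist_def using xy
    by (intro sin_ge_zero arccos_lbound arccos_ubound) (auto simp: abs_le_iff)
  then have nv': "norm v = sin t" using nv by (simp add: power2_eq_iff_nonneg)
  show thesis
  proof (cases "sin t = 0")
    case False
    show thesis
    proof (rule that[of "v /\<^sub>R sin t"])
      show "norm (v /\<^sub>R sin t) = 1" using False nv' s0 by simp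
    qed (use False xv in \<open>simp_all add: t_def[symmetric] v_def\<close>)
  next
    case True
    then have y: "y = cos t *\<^sub>R x" using nv' by (simp add: v_def)
    obtain e :: "real^3" where "norm e = 1" "orthogonal x e"
    proof -
      obtain u :: "real^3" where "u \<noteq> 0" "orthogonal x u"
        using orthogonal_to_vector_exists[of x] by (auto simp: DIM_cart)
      then show thesis using that[of "u /\<^sub>R norm u"] by (simp add: orthogonal_def)
    qed
    then have "norm e = 1" "x \<bullet> e = 0" "y = cos t *\<^sub>R x + sin t *\<^sub>R e"
      using y True by (auto simp: orthogonal_def)
    then show thesis unfolding t_def by (rule that)
  qed
qed

lemma nn_integral_bump_sector:
  assumes \<theta>: "0 < \<theta>" "\<theta> < pi" and \<delta>: "1 < \<delta>" and a: "0 \<le> a" "a < pi / 2"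
    and A: "{tan a<..} \<subseteq> A" "A \<subseteq> {tan a..}" "A \<in> sets borel"
    and x: "norm x = 1" and e: "norm e = 1" "x \<bullet> e = 0"
  shows "(\<integral>\<^sup>+z. bump \<theta> \<delta> x z * indicator {z. (z \<bullet> e) / (z \<bullet> x) \<in> A} z \<partial>lborel)
    = ennreal (pi / 6 * trunc_power \<theta> \<delta> (2 * a))"
proof -
  have "tail_weight \<theta> \<delta> s = 0" if "s \<notin> {0<..<1}" for s
    using that abs_square_le_1[of "sin (\<theta> / 2)"] by (auto simp: tail_weight_def indicator_def)
  then show ?thesis
    using nn_integral_abel_profile_cone[OF x e borel_measurable_tail_weight A(3), of \<theta> \<delta>]
      nn_integral_sector_tail_weight[OF \<theta> \<delta> a A(1,2)]
    by (simp add: bump_def mult_ac)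
qed

lemma bump_mono:
  assumes \<theta>: "0 < \<theta>" "\<theta> \<le> 1 / 2" and \<delta>: "3 / 2 \<le> \<delta>" and x: "norm x = 1" "norm y = 1"
    and le: "z \<bullet> x \<le> z \<bullet> y"
  shows "bump \<theta> \<delta> x z \<le> bump \<theta> \<delta> y z"
proof (cases "norm z \<le> 1 \<and> 0 < z \<bullet> x")
  case True
  then have z: "0 < norm z" by auto
  have "z \<bullet> x / norm z \<le> z \<bullet> y / norm z" "0 \<le> z \<bullet> x / norm z" using le z True by (auto intro: divide_right_mono)
  then have "(z \<bullet> x / norm z)\<^sup>2 \<le> (z \<bullet> y / norm z)\<^sup>2" by (intro power_mono) auto
  moreover have "\<bar>z \<bullet> y / norm z\<bar> \<le> 1" using Cauchy_Schwarz_ineq2[of z y] x z by (simp add: divide_le_eq)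
  then have "(z \<bullet> y / norm z)\<^sup>2 \<le> 1" by (simp add: abs_square_le_1)
  ultimately show ?thesis using True le
    by (auto simp: bump_def intro!: abel_transform_tail_weight_antimono \<theta> \<delta>)
qed (auto simp: bump_def)

text \<open>
  The frames \<open>(x, e)\<close> and \<open>(y, e')\<close> are mirror images in the plane bisecting \<open>x\<close> and \<open>y\<close>. Points with slope
  above \<open>tan (t / 2)\<close> in the first frame are nearer to \<open>y\<close>, and there \<open>h\<^sub>x\<close> is the smaller function; the
  remaining points have slope at least \<open>tan (t / 2)\<close> in the second frame, and there \<open>h\<^sub>y\<close> is the
  smaller one. Each side contributes half of the integral. For \<open>x = y\<close> the argument still works,
  with an arbitrary \<open>e\<close>.
\<close>

lemma nn_integral_min_bump:
  assumes \<theta>: "0 < \<theta>" "\<theta> \<le> 1 / 2" and \<delta>: "3 / 2 \<le> \<delta>" and x: "norm x = 1" and y: "norm y = 1"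
  shows "(\<integral>\<^sup>+z. min (bump \<theta> \<delta> x z) (bump \<theta> \<delta> y z) \<partial>lborel)
    = ennreal (pi / 3 * trunc_power \<theta> \<delta> (geodesic_dist x y))"
proof -
  define t where "t = geodesic_dist x y"
  have xy: "\<bar>x \<bullet> y\<bar> \<le> 1" using Cauchy_Schwarz_ineq2[of x y] x y by simp
  have t0: "0 \<le> t" "t \<le> pi" using xy by (auto simp: t_def geodesic_dist_def abs_le_iff intro!: arccos_lbound arccos_ubound)
  obtain e where e: "norm e = 1" "x \<bullet> e = 0" and ye: "y = cos t *\<^sub>R x + sin t *\<^sub>R e"
    using sphere_frame[OF x y] unfolding t_def by metis
  have pi: "\<theta> < pi" using \<theta> pi_gt3 by simp
  show ?thesis
  \<comment> \<open>For antipodal points \<open>tan (t / 2)\<close> is meaningless, but the two supports are disjoint.\<close>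
  proof (cases "t = pi")
    case True
    then have "y = - x" using ye by simp
    then have "min (bump \<theta> \<delta> x z) (bump \<theta> \<delta> y z) = 0" for z
      by (auto simp: bump_def indicator_def)
    then show ?thesis using True pi by (simp add: t_def[symmetric] trunc_power_def)
  next
    case False
    define T where "T = tan (t / 2)"
    have h: "0 \<le> t / 2" "t / 2 < pi / 2" using t0 False by auto
    have ch: "0 < cos (t / 2)" using h by (intro cos_gt_zero_pi) auto
    have T: "cos t + T * sin t = 1" "sin t - T * cos t = T"
    proof -
      have 1: "cos t = 1 - 2 * (sin (t/2))\<^sup>2" "sin t = 2 * sin (t/2) * cos (t/2)"
        using cos_double_sin[of "t/2"] sin_double[of "t/2"] by simp_all
      show "cos t + T * sin t = 1" unfolding 1 T_def tan_def using ch by (simp add: power2_eq_square)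
      have "sin t - T * cos t = T * (2 * (cos (t/2))\<^sup>2 - 1 + 2 * (sin (t/2))\<^sup>2)"
        unfolding 1 T_def tan_def using ch by (simp add: field_simps power2_eq_square)
      moreover have "2 * (cos (t/2))\<^sup>2 - 1 + 2 * (sin (t/2))\<^sup>2 = 1"
        using sin_cos_squared_add[of "t/2"] by linarith
      ultimately show "sin t - T * cos t = T" by simp
    qed
    have sT: "0 \<le> sin t" using t0 by (intro sin_ge_zero)
    define e' where "e' = sin t *\<^sub>R x - cos t *\<^sub>R e"
    have ip: "x \<bullet> x = 1" "e \<bullet> e = 1" "e \<bullet> x = 0" using x e by (auto simp: norm_eq_1 inner_commute)
    have e': "norm e' = 1" "y \<bullet> e' = 0"
      by (simp_all add: e'_def ye norm_eq_1 inner_diff_left inner_diff_right inner_add_left ip e sin_cos_squared_add2 flip: power2_eq_square)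
    have zy: "z \<bullet> y = cos t * (z \<bullet> x) + sin t * (z \<bullet> e)" for z by (simp add: ye inner_add_right)
    \<comment> \<open>The two slope conditions are complementary.\<close>
    have ze': "z \<bullet> e' - T * (z \<bullet> y) = T * (z \<bullet> x) - z \<bullet> e" for z
    proof -
      have "z \<bullet> e' - T * (z \<bullet> y) = (sin t - T * cos t) * (z \<bullet> x) - (cos t + T * sin t) * (z \<bullet> e)"
        by (simp add: e'_def zy inner_diff_right algebra_simps)
      then show ?thesis unfolding T by simp
    qed
    have zx: "z \<bullet> x = cos t * (z \<bullet> y) + sin t * (z \<bullet> e')" for z
    proof -
      have "cos t * (cos t * a + sin t * b) + sin t * (sin t * a - cos t * b) = ((cos t)\<^sup>2 + (sin t)\<^sup>2) * a" for a b
        by algebra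
      then show ?thesis by (simp add: e'_def zy inner_diff_right)
    qed
    let ?G = "\<lambda>x e A z. bump \<theta> \<delta> x z * indicator {z. (z \<bullet> e) / (z \<bullet> x) \<in> A} z"
    have split: "min (bump \<theta> \<delta> x z) (bump \<theta> \<delta> y z) = ?G x e {T<..} z + ?G y e' {T..} z" for z
    proof (cases "T * (z \<bullet> x) < z \<bullet> e")
      case True
      have "(cos t + T * sin t) * (z \<bullet> x) \<le> z \<bullet> y"
        unfolding zy using mult_left_mono[OF less_imp_le[OF True] sT] by (simp add: algebra_simps)
      then have "z \<bullet> x \<le> z \<bullet> y" unfolding T by simp
      then have "min (bump \<theta> \<delta> x z) (bump \<theta> \<delta> y z) = bump \<theta> \<delta> x z"
        using bump_mono[OF \<theta> \<delta> x y] by (simp add: min_absorb1)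
      also have "\<dots> = ?G x e {T<..} z"
        using True by (auto simp: bump_def indicator_def less_divide_eq)
      also have "?G y e' {T..} z = 0"
        using True ze'[of z] by (auto simp: bump_def indicator_def le_divide_eq)
      ultimately show ?thesis by simp
    next
      case False
      then have F: "T * (z \<bullet> y) \<le> z \<bullet> e'" using ze'[of z] by simp
      have "(cos t + T * sin t) * (z \<bullet> y) \<le> z \<bullet> x"
        unfolding zx[of z] using mult_left_mono[OF F sT] by (simp add: algebra_simps)
      then have "z \<bullet> y \<le> z \<bullet> x" unfolding T by simp
      then have "min (bump \<theta> \<delta> x z) (bump \<theta> \<delta> y z) = bump \<theta> \<delta> y z"
        using bump_mono[OF \<theta> \<delta> y x] by (simp add: min_absorb2)
      also have "\<dots> = ?G y e' {T..} z"
        using F by (auto simp: bump_def indicator_def le_divide_eq)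
      finally have "min (bump \<theta> \<delta> x z) (bump \<theta> \<delta> y z) = ?G y e' {T..} z" .
      moreover have "?G x e {T<..} z = 0"
        using False by (auto simp: bump_def indicator_def less_divide_eq)
      ultimately show ?thesis by simp
    qed
    have \<delta>1: "1 < \<delta>" using \<delta> by simp
    have [measurable]: "?G x e {T<..} \<in> borel_measurable borel" "?G y e' {T..} \<in> borel_measurable borel"
      by measurable
    have "(\<integral>\<^sup>+z. min (bump \<theta> \<delta> x z) (bump \<theta> \<delta> y z) \<partial>lborel)
      = (\<integral>\<^sup>+z. ?G x e {T<..} z \<partial>lborel) + (\<integral>\<^sup>+z. ?G y e' {T..} z \<partial>lborel)"
      unfolding split by (rule nn_integral_add) measurable
    also have "(\<integral>\<^sup>+z. ?G x e {T<..} z \<partial>lborel) = ennreal (pi / 6 * trunc_power \<theta> \<delta> (2 * (t / 2)))"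
      by (rule nn_integral_bump_sector[OF \<theta>(1) pi \<delta>1 h _ _ _ x e]) (auto simp: T_def)
    also have "(\<integral>\<^sup>+z. ?G y e' {T..} z \<partial>lborel) = ennreal (pi / 6 * trunc_power \<theta> \<delta> (2 * (t / 2)))"
      by (rule nn_integral_bump_sector[OF \<theta>(1) pi \<delta>1 h _ _ _ y e']) (auto simp: T_def)
    also have "ennreal (pi / 6 * trunc_power \<theta> \<delta> (2 * (t / 2))) + ennreal (pi / 6 * trunc_power \<theta> \<delta> (2 * (t / 2)))
      = ennreal (pi / 3 * trunc_power \<theta> \<delta> t)"
      by (subst ennreal_plus[symmetric]) (simp_all add: trunc_power_def)
    finally show ?thesis unfolding t_def .
  qed
qed

text \<open>
  Both centres are within distance \<open>sqrt (2 w)\<close> of the direction of \<open>z\<close>, because the cosine \<open>r\<close>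
  satisfies \<open>r \<ge> r\<^sup>2 > 1 - w\<close>. Hence they are less than \<open>sqrt (8 w)\<close> apart.
\<close>

lemma caps_disjoint:
  fixes x y z :: "real^3"
  assumes x: "norm x = 1" "norm y = 1" and w: "0 \<le> w" "w \<le> 1" "8 * w \<le> (norm (x - y))\<^sup>2"
    and z: "0 < z \<bullet> x" "1 - (z \<bullet> x / norm z)\<^sup>2 < w" "0 < z \<bullet> y" "1 - (z \<bullet> y / norm z)\<^sup>2 < w"
  shows False
proof -
  have nz: "0 < norm z" using z by auto
  define u where "u = z /\<^sub>R norm z"
  have u: "norm u = 1" using nz by (simp add: u_def)
  have near: "(norm (u - v))\<^sup>2 < 2 * w" if v: "norm v = 1" "0 < z \<bullet> v" "1 - (z \<bullet> v / norm z)\<^sup>2 < w" for v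
  proof -
    define r where "r = u \<bullet> v"
    have r: "r = z \<bullet> v / norm z" "0 < r" using v nz by (auto simp: r_def u_def divide_inverse mult.commute)
    have "r \<le> 1" using Cauchy_Schwarz_ineq2[of u v] u v r_def by simp
    then have "r * r \<le> r" using r(2) mult_left_le[of r r] by simp
    then have "1 - w < r" using v(3) r by (simp add: power2_eq_square)
    moreover have "(norm (u - v))\<^sup>2 = 2 - 2 * r"
      using u v by (simp add: power2_norm_eq_inner inner_diff_left inner_diff_right norm_eq_1 r_def inner_commute)
    ultimately show ?thesis by simp
  qed
  have "(norm (x - y))\<^sup>2 \<le> (norm (u - x) + norm (u - y))\<^sup>2"
    using norm_triangle_ineq4[of "u - y" "u - x"] by (intro power_mono) (auto simp: algebra_simps)
  also have "\<dots> \<le> 2 * (norm (u - x))\<^sup>2 + 2 * (norm (u - y))\<^sup>2"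
    using zero_le_power2[of "norm (u - x) - norm (u - y)"] by (simp add: power2_eq_square algebra_simps)
  also have "\<dots> < 8 * w" using near[of x] near[of y] x z by simp
  finally show False using w by simp
qed

text \<open>
  The quadratic form is, up to the factor \<open>\<pi> / 3\<close>, the integral of the quadratic forms \<open>Q z\<close> of
  the minimum matrices. Each \<open>Q z\<close> is bounded below by the excess of one \<open>h k\<close> over a level \<open>M\<close>, and
  this excess is positive on a nonempty open set.
\<close>

lemma isotropic_positive_definite_trunc_power:
  assumes \<theta>: "0 < \<theta>" "\<theta> \<le> 1 / 2" and \<delta>: "3 / 2 \<le> \<delta>"
  shows "isotropic_positive_definite (trunc_power \<theta> \<delta>)"
  unfolding isotropic_positive_definite_def positive_definite_def
proof (intro allI impI, elim conjE exE)
  fix N :: nat and x :: "nat \<Rightarrow> real^3" and c :: "nat \<Rightarrow> real" and k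
  assume sph: "\<forall>i<N. x i \<in> sphere 0 1" and inj: "inj_on x {..<N}" and k: "k < N" "c k \<noteq> 0"
  have x: "norm (x i) = 1" if "i < N" for i using sph that by simp
  define B where "B = (\<lambda>i z. bump \<theta> \<delta> (x i) z)"
  define h where "h = (\<lambda>i z. enn2real (B i z))"
  define Q where "Q = (\<lambda>z. \<Sum>i<N. \<Sum>j<N. c i * c j * min (h i z) (h j z))"
  have Bm[measurable]: "B i \<in> borel_measurable borel" for i unfolding B_def by measurable
  have hm[measurable]: "h i \<in> borel_measurable borel" for i unfolding h_def by measurable
  have Qm[measurable]: "Q \<in> borel_measurable borel" unfolding Q_def by measurable
  have int: "(\<integral>\<^sup>+z. min (B i z) (B j z) \<partial>lborel) = ennreal (pi / 3 * trunc_power \<theta> \<delta> (geodesic_dist (x i) (x j)))"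
    if "i < N" "j < N" for i j
    unfolding B_def using nn_integral_min_bump[OF \<theta> \<delta> x x] that by blast
  have fin: "AE z in lborel. B i z \<noteq> \<infinity>" if "i < N" for i
    using int[OF that that] by (intro nn_integral_PInf_AE) auto
  have hb: "has_bochner_integral lborel (\<lambda>z. min (h i z) (h j z)) (pi / 3 * trunc_power \<theta> \<delta> (geodesic_dist (x i) (x j)))"
    if ij: "i < N" "j < N" for i j
  proof (rule has_bochner_integral_nn_integral)
    have "(\<integral>\<^sup>+z. ennreal (min (h i z) (h j z)) \<partial>lborel) = (\<integral>\<^sup>+z. min (B i z) (B j z) \<partial>lborel)"
      using fin[OF ij(1)] fin[OF ij(2)]
    proof (intro nn_integral_cong_AE, eventually_elim)
      case (elim z)
      then show ?case by (cases "B i z"; cases "B j z") (auto simp: h_def min_def)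
    qed
    then show "(\<integral>\<^sup>+z. ennreal (min (h i z) (h j z)) \<partial>lborel) = ennreal (pi / 3 * trunc_power \<theta> \<delta> (geodesic_dist (x i) (x j)))"
      using int[OF ij] by simp
  qed (auto simp: h_def trunc_power_def)
  have Qint: "has_bochner_integral lborel Q (\<Sum>i<N. \<Sum>j<N. c i * c j * (pi / 3 * trunc_power \<theta> \<delta> (geodesic_dist (x i) (x j))))"
    unfolding Q_def by (intro has_bochner_integral_sum has_bochner_integral_mult_right hb) auto
  have form: "(\<integral>z. Q z \<partial>lborel) = pi / 3 * (\<Sum>i<N. \<Sum>j<N. c i * trunc_power \<theta> \<delta> (geodesic_dist (x i) (x j)) * c j)"
    unfolding has_bochner_integral_integral_eq[OF Qint] by (simp add: sum_distrib_left mult_ac)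
  let ?T = "(sin (\<theta> / 2))\<^sup>2" and ?a = "abel_transform (tail_weight \<theta> \<delta>)"
  have T: "0 < ?T" "?T \<le> 1" using \<theta> pi_gt3 sin_gt_zero[of "\<theta>/2"] abs_square_le_1[of "sin (\<theta>/2)"] by auto
  \<comment> \<open>\<open>M\<close> is the value of the profile at a \<open>w\<close> so small that the caps where it is exceeded are disjoint.\<close>
  define D where "D = insert ?T ((\<lambda>(i, j). (norm (x i - x j))\<^sup>2 / 8) ` {(i, j). i < N \<and> j < N \<and> i \<noteq> j})"
  have Dfin: "finite D"
  proof -
    have "finite {(i, j). i < N \<and> j < N \<and> i \<noteq> j}" by (rule finite_subset[of _ "{..<N} \<times> {..<N}"]) auto
    then show ?thesis unfolding D_def by simp
  qed
  have Dpos: "0 < d" if "d \<in> D" for d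
    using that T inj by (auto simp: D_def inj_on_def)
  define w where "w = Min D"
  have w: "0 < w" "w \<le> ?T" and wD: "\<And>d. d \<in> D \<Longrightarrow> w \<le> d"
    using Dfin Dpos Min_in[OF Dfin] by (auto simp: w_def D_def)
  have afin: "?a w < \<infinity>" by (rule abel_transform_tail_weight_finite[OF \<theta> \<delta> w(1)])
  define M where "M = enn2real (?a w)"
  have M0: "0 \<le> M" by (simp add: M_def)
  have aM: "?a w = ennreal M" using afin by (simp add: M_def)
  have level: "norm z \<le> 1 \<and> 0 < z \<bullet> x i \<and> 1 - (z \<bullet> x i / norm z)\<^sup>2 < w" if "M < h i z" for i z
  proof -
    have "ennreal M < B i z" using that M0
      by (cases "B i z") (auto simp: h_def ennreal_less_iff)
    moreover from this have z: "norm z \<le> 1 \<and> 0 < z \<bullet> x i"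
      by (rule contrapos_pp) (simp add: B_def bump_def)
    ultimately have "?a w < ?a (1 - (z \<bullet> x i / norm z)\<^sup>2)"
      by (simp add: B_def bump_def aM)
    then have "\<not> w \<le> 1 - (z \<bullet> x i / norm z)\<^sup>2"
      using abel_transform_tail_weight_antimono[OF \<theta> \<delta>, of w "1 - (z \<bullet> x i / norm z)\<^sup>2"] w by (auto simp: not_le[symmetric])
    then show ?thesis using z by simp
  qed
  have one: "i = j" if "i < N" "j < N" "M < h i z" "M < h j z" for i j z
  proof (rule ccontr)
    assume "i \<noteq> j"
    then have "(norm (x i - x j))\<^sup>2 / 8 \<in> D" using that by (auto simp: D_def)
    then have "8 * w \<le> (norm (x i - x j))\<^sup>2" using wD by fastforce
    then show False
      using caps_disjoint[OF x[OF that(1)] x[OF that(2)], of w z] level[OF that(3)] level[OF that(4)] w T by auto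
  qed
  have Qge: "(c k)\<^sup>2 * max 0 (h k z - M) \<le> Q z" for z
    unfolding Q_def using k one by (intro sum_min_ge_excess M0) (auto simp: h_def)
  have Q0: "0 \<le> Q z" for z using Qge[of z] by (smt (verit) mult_nonneg_nonneg zero_le_power2)
  have "(\<integral>z. Q z \<partial>lborel) \<noteq> 0"
  proof
    \<comment> \<open>A vanishing integral would force \<open>h k \<le> M\<close> almost everywhere, also on the open cone \<open>U\<close> about \<open>x k\<close>.\<close>
    assume "(\<integral>z. Q z \<partial>lborel) = 0"
    then have "AE z in lborel. Q z = 0"
      using integral_nonneg_eq_0_iff_AE[of lborel Q] Qint Q0 by (auto simp: has_bochner_integral_iff)
    then have small: "AE z in lborel. h k z \<le> M"
    proof eventually_elim
      case (elim z)
      then have "(c k)\<^sup>2 * max 0 (h k z - M) \<le> 0" using Qge[of z] by simp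
      then show ?case using k by (simp add: mult_le_0_iff)
    qed
    define U where "U = {z. norm z < 1} \<inter> {z. 0 < z \<bullet> x k} \<inter> {z. (1 - w) * (norm z)\<^sup>2 < (z \<bullet> x k)\<^sup>2}"
    have "open U" unfolding U_def
      by (intro open_Int open_Collect_less continuous_intros)
    moreover have "(1/2) *\<^sub>R x k \<in> U"
    proof -
      have "x k \<bullet> x k = 1" using x[OF k(1)] by (simp add: norm_eq_1)
      then show ?thesis using w(1) by (simp add: U_def x[OF k(1)] power2_eq_square)
    qed
    ultimately have "\<not> negligible U" using open_not_negligible[of U] by blast
    have "AE z in lborel. z \<notin> U"
      using small fin[OF k(1)]
    proof eventually_elim
      case (elim z)
      show ?case
      proof
        assume z: "z \<in> U"
        then have nz: "0 < norm z" by (auto simp: U_def)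
        have "1 - (z \<bullet> x k / norm z)\<^sup>2 < w"
          using z nz by (simp add: U_def power_divide field_simps)
        moreover have "\<bar>z \<bullet> x k / norm z\<bar> \<le> 1" using Cauchy_Schwarz_ineq2[of z "x k"] x[OF k(1)] nz by (simp add: divide_le_eq)
        then have "0 \<le> 1 - (z \<bullet> x k / norm z)\<^sup>2" by (simp add: abs_square_le_1)
        ultimately have "?a w < ?a (1 - (z \<bullet> x k / norm z)\<^sup>2)"
          using w by (intro abel_transform_tail_weight_less \<theta> \<delta>) auto
        then have "ennreal M < B k z" using z by (auto simp: B_def bump_def U_def aM)
        then have "M < h k z" using elim(2) M0
          by (cases "B k z") (auto simp: h_def ennreal_less_iff)
        then show False using elim(1) by simp
      qed
    qed
    then have "U \<in> null_sets lborel"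
      using \<open>open U\<close> by (simp add: AE_iff_null_sets)
    then have "negligible U"
      by (simp add: negligible_iff_null_sets null_sets_completionI)
    then show False using \<open>\<not> negligible U\<close> by simp
  qed
  moreover have "0 \<le> (\<integral>z. Q z \<partial>lborel)" using Q0 by simp
  ultimately have "0 < pi / 3 * (\<Sum>i<N. \<Sum>j<N. c i * trunc_power \<theta> \<delta> (geodesic_dist (x i) (x j)) * c j)"
    unfolding form by linarith
  then show "0 < (\<Sum>i<N. \<Sum>j<N. c i * trunc_power \<theta> \<delta> (geodesic_dist (x i) (x j)) * c j)"
    by (simp add: zero_less_mult_iff)
qed

theorem theorem1p9:
  shows "\<exists>c::real. 0 < c \<and> c < pi \<and>
    (\<forall>\<delta> \<theta> :: real. \<delta> \<ge> 3/2 \<longrightarrow> 0 < \<theta> \<longrightarrow> \<theta> \<le> c \<longrightarrow>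
       isotropic_positive_definite (trunc_power \<theta> \<delta>))"
  using pi_gt3 isotropic_positive_definite_trunc_power
  by (intro exI[of _ "1/2"]) auto

end
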